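(* Consider the bilinear system on $\mathrm{GL}^+(n)$ $$\dot X(t)=AX(t)+\Big(\sum_{k=1}^m u_k(t)E_{i_kj_k}\Big)X(t),\qquad X(0)=I_n,$$ with $A\in\mathfrak{gl}(n)$ and $E_{i_kj_k}\in\{E_{ij}:1\le i,j\le n\}$ for $k=1,\dots,m$ (the case $i_k=j_k$ being allowed). Suppose the weakly connected components of $\mathcal{G}^{\ast}_{\rm contr}$ are all strongly connected with at least two nodes, and one of them contains at least three nodes. Then the system is accessible on $\mathrm{GL}^+(n)$ if and only if the following conditions hold: (i) the union digraph $\mathcal{G}^{\ast}_{\rm drift}\cup\mathcal{G}^{\ast}_{\rm contr}:=(\mathrm{V},\mathcal{E}^{\ast}_{\rm drift}\cup\mathcal{E}^{\ast}_{\rm contr})$ is strongly connected; (ii) $\mathcal{G}^{\ast}_{\rm contr}$ has at least one self-loop or $\operatorname{tr}A\ne 0$.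
   Context: $\mathrm{GL}^+(n)$ is the connected component containing the identity $I_n$ of the group of real invertible $n\times n$ matrices, and its Lie algebra is $\mathfrak{gl}(n)=\mathbb{R}^{n\times n}$. $E_{ij}\in\mathbb{R}^{n\times n}$ has $(i,j)$-entry $1$ and all other entries $0$. The controls $u_k(t)\in\mathbb{R}$ are piecewise constant signals. For $T\ge 0$, $\mathcal{R}_T(I_n)$ is the set of all terminal points $X(T)$ of solutions of the system with $X(0)=I_n$ (over all admissible controls), and $\mathcal{R}(I_n)=\bigcup_{T\ge 0}\mathcal{R}_T(I_n)$. The system is accessible on $\mathrm{GL}^+(n)$ if $\mathcal{R}(I_n)$ has an interior point in $\mathrm{GL}^+(n)$. Let $\mathrm{V}=\{1,\dots,n\}$. The drift interaction graph is the digraph $\mathcal{G}^{\ast}_{\rm drift}=(\mathrm{V},\mathcal{E}^{\ast}_{\rm drift})$ where, for $i,j\in\mathrm{V}$, $(i,j)\in\mathcal{E}^{\ast}_{\rm drift}$ if and only if $[A]_{ij}\ne 0$. The controlled interaction graph is the digraph $\mathcal{G}^{\ast}_{\rm contr}=(\mathrm{V},\mathcal{E}^{\ast}_{\rm contr})$ with arc set $\mathcal{E}^{\ast}_{\rm contr}=\{(i_1,j_1),\dots,(i_m,j_m)\}$. Both may have self-loops $(i,i)$. A digraph is strongly connected if every two nodes are mutually reachable by directed paths; a node is reachable from itself. A weakly connected component of a digraph is a connected component when arc directions are ignored (a node with no arcs to or from other nodes is a component with one node). *)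

theory Defs
  imports "Graph_Theory.Digraph_Component" "HOL-Analysis.Analysis"
begin

definition GL_plus :: "(real^'n^'n) set" where
  "GL_plus = connected_component_set {X. invertible X} (mat 1)"

definition E_mat :: "'n \<Rightarrow> 'n \<Rightarrow> real^'n^'n" where
  "E_mat i j = (\<chi> r c. if r = i \<and> c = j then 1 else 0)"

text \<open>The values at the finitely many switching times are left arbitrary.\<close>

definition piecewise_constant :: "real \<Rightarrow> (real \<Rightarrow> real) \<Rightarrow> bool" where
  "piecewise_constant T u \<longleftrightarrow>
     (\<exists>S. finite S \<and> (\<forall>a b. {a<..<b} \<subseteq> {0..T} - S \<longrightarrow> u constant_on {a<..<b}))"

text \<open>Since the controls may jump, a solution is a continuous curve that satisfies the differential
  equation at all but finitely many times.\<close>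

definition trajectory ::
  "real^'n^'n \<Rightarrow> nat \<Rightarrow> (nat \<Rightarrow> 'n) \<Rightarrow> (nat \<Rightarrow> 'n) \<Rightarrow> (nat \<Rightarrow> real \<Rightarrow> real) \<Rightarrow> real
     \<Rightarrow> (real \<Rightarrow> real^'n^'n) \<Rightarrow> bool" where
  "trajectory A m i j u T X \<longleftrightarrow>
     continuous_on {0..T} X \<and> X ` {0..T} \<subseteq> GL_plus \<and> X 0 = mat 1 \<and>
     (\<exists>S. finite S \<and>
        (\<forall>t \<in> {0..T} - S.
           (X has_vector_derivative
              A ** X t + (\<Sum>k = 1..m. u k t *\<^sub>R E_mat (i k) (j k)) ** X t)
             (at t within {0..T})))"

definition reachable_at ::
  "real^'n^'n \<Rightarrow> nat \<Rightarrow> (nat \<Rightarrow> 'n) \<Rightarrow> (nat \<Rightarrow> 'n) \<Rightarrow> real \<Rightarrow> (real^'n^'n) set" where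
  "reachable_at A m i j T =
     {X T | X u. (\<forall>k \<in> {1..m}. piecewise_constant T (u k)) \<and> trajectory A m i j u T X}"

definition reachable_set ::
  "real^'n^'n \<Rightarrow> nat \<Rightarrow> (nat \<Rightarrow> 'n) \<Rightarrow> (nat \<Rightarrow> 'n) \<Rightarrow> (real^'n^'n) set" where
  "reachable_set A m i j = (\<Union>T \<in> {0..}. reachable_at A m i j T)"

definition accessible ::
  "real^'n^'n \<Rightarrow> nat \<Rightarrow> (nat \<Rightarrow> 'n) \<Rightarrow> (nat \<Rightarrow> 'n) \<Rightarrow> bool" where
  "accessible A m i j \<longleftrightarrow> (top_of_set GL_plus) interior_of (reachable_set A m i j) \<noteq> {}"

definition drift_graph :: "real^'n^'n \<Rightarrow> ('n, 'n \<times> 'n) pre_digraph" where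
  "drift_graph A = with_proj \<lparr>pverts = UNIV, parcs = {(v, w). A $ v $ w \<noteq> 0}\<rparr>"

definition contr_graph ::
  "nat \<Rightarrow> (nat \<Rightarrow> 'n) \<Rightarrow> (nat \<Rightarrow> 'n) \<Rightarrow> ('n, 'n \<times> 'n) pre_digraph" where
  "contr_graph m i j = with_proj \<lparr>pverts = UNIV, parcs = (\<lambda>k. (i k, j k)) ` {1..m}\<rparr>"

text \<open>The constant \<^const>\<open>Digraph_Component.connected\<close> is connectedness of the underlying
  undirected graph, so its maximal subgraphs are the weakly connected components.\<close>

definition weak_components :: "('a, 'b) pre_digraph \<Rightarrow> ('a, 'b) pre_digraph set" where
  "weak_components G = {H. pre_digraph.max_subgraph G Digraph_Component.connected H}"

end

theory Submission
  imports Defs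
begin

text \<open>
  Piecewise constant controls make the reachable set equal to the semigroup generated by the
  matrices \<open>exp (s Y)\<close> with \<open>s \<ge> 0\<close> and \<open>Y\<close> in the family of all
  \<open>A + (\<Sum>k = 1..m. c k *\<^sub>R E_mat (i k) (j k))\<close> (\<open>reachable_set_eq_flow_semigroup\<close>). Everything is then a question about
  this semigroup.

  \<^emph>\<open>Necessity.\<close> If the union digraph is not strongly connected, the set \<open>V\<close> of vertices reachable
  from a suitable vertex is proper and closed under arcs, so every member of the family, hence every
  product of exponentials, vanishes on \<open>V \<times> -V\<close>. If there is no self-loop and the trace of \<open>A\<close> is
  zero, all members have trace zero, and by Liouville's formula all reachable matrices have determinant
  one. Neither condition can hold on an open set.

  \<^emph>\<open>Sufficiency, analytic half.\<close> Consider local maps into the semigroup that are differentiable at a base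
  point, and translate their derivative \<open>L\<close> there back to the identity. Take \<open>L\<close> of maximal rank. Multiplying such a map
  by one more exponential \<open>exp ((s + \<phi> x) Y)\<close>, where the linear form \<open>\<phi>\<close> detects a kernel vector of
  \<open>L\<close>, would increase the rank unless \<open>Y\<close> lies in the range of \<open>L\<close>; and it conjugates the range by
  \<open>exp (s Y)\<close>. So the intersection \<open>U\<close> of all ranges of maximal rank contains the family, and conjugation
  by \<open>exp (-s Y)\<close> maps \<open>U\<close> into each of these ranges; differentiating at \<open>s = 0\<close> shows that \<open>U\<close> is
  stable under bracketing with the family. If the family generates the Lie algebra of all matrices, \<open>U\<close>
  is everything, the rank is full, and the open mapping property of maps with surjective derivative
  gives an interior point (\<open>interior_flow_semigroup_nonempty\<close>).

  \<^emph>\<open>Sufficiency, algebraic half.\<close> Let \<open>N\<close> be a Lie subalgebra that contains \<open>A\<close> and the controlled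
  \<open>E_mat i j\<close>. Paths in a strongly connected component give \<open>E_mat v w \<in> N\<close> for all distinct \<open>v\<close>, \<open>w\<close> of
  the component. For a component with three vertices \<open>c\<close>, \<open>c'\<close>, \<open>c''\<close> and vertices \<open>d \<noteq> d'\<close> of
  another one,
  \<open>[[E_mat c' c, B], E_mat d d'] = B\<^bsub>cd\<^esub> E_mat c' d' + B\<^bsub>d'c'\<^esub> E_mat d c\<close>, and the
  spare vertex \<open>c''\<close> separates the two summands (\<open>separate_E_mat\<close>). Two components with two vertices
  each would not allow this separation. Walking along the union digraph from and to the
  component with three vertices yields all off-diagonal \<open>E_mat v w\<close>, hence all trace-free matrices, and
  the self-loop or the trace of \<open>A\<close> supplies the missing dimension (\<open>lie_subalgebra_eq_UNIV\<close>).
\<close>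

section \<open>Weak components of the control graph\<close>

lemma reachable_with_proj_iff:
  "u \<rightarrow>\<^sup>*\<^bsub>with_proj \<lparr>pverts = UNIV, parcs = R\<rparr>\<^esub> v \<longleftrightarrow> (u, v) \<in> R\<^sup>*"
proof
  assume "u \<rightarrow>\<^sup>*\<^bsub>with_proj \<lparr>pverts = UNIV, parcs = R\<rparr>\<^esub> v"
  then have "(u, v) \<in> rtrancl_on UNIV R"
    by (simp add: reachable_def)
  then show "(u, v) \<in> R\<^sup>*"
    by (induction rule: rtrancl_on_induct) (auto intro: rtrancl_into_rtrancl)
next
  assume "(u, v) \<in> R\<^sup>*"
  then have "(u, v) \<in> rtrancl_on UNIV R"
    by (induction rule: rtrancl_induct) (auto intro: rtrancl_on_into_rtrancl_on)
  then show "u \<rightarrow>\<^sup>*\<^bsub>with_proj \<lparr>pverts = UNIV, parcs = R\<rparr>\<^esub> v"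
    by (simp add: reachable_def)
qed

text \<open>A connected subgraph containing \<open>H0\<close> with the largest number of vertices and arcs is maximal with
  respect to inclusion. Applied to a single vertex or a single arc, this locates them in a component.\<close>

lemma connected_subgraph_in_weak_component:
  fixes G :: "('a, 'b) pre_digraph"
  assumes "fin_digraph G" "subgraph H0 G" "Digraph_Component.connected H0"
  shows "\<exists>H \<in> weak_components G. subgraph H0 H"
proof -
  interpret fin_digraph G by fact
  define P where "P H \<longleftrightarrow> subgraph H G \<and> Digraph_Component.connected H \<and> subgraph H0 H" for H
  define s where "s H = card (verts H) + card (arcs H)" for H :: "('a, 'b) pre_digraph"
  have "P H0"
    using assms unfolding P_def subgraph_def compatible_def by auto
  have "\<forall>H. P H \<longrightarrow> s H < card (verts G) + card (arcs G) + 1"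
  proof (intro allI impI)
    fix H assume "P H"
    then have "verts H \<subseteq> verts G" "arcs H \<subseteq> arcs G"
      by (auto simp: P_def subgraph_def)
    then have "card (verts H) \<le> card (verts G)" "card (arcs H) \<le> card (arcs G)"
      by (auto intro: card_mono)
    then show "s H < card (verts G) + card (arcs G) + 1"
      by (simp add: s_def)
  qed
  then obtain H where H: "P H" "\<forall>H'. P H' \<longrightarrow> s H' \<le> s H"
    using ex_has_greatest_nat[of P H0 s] \<open>P H0\<close> by blast
  have "H' = H" if "subgraph H H'" "subgraph H' G" "Digraph_Component.connected H'" for H'
  proof -
    have "P H'"
      using that \<open>P H\<close> unfolding P_def subgraph_def compatible_def by auto
    then have le: "s H' \<le> s H"
      using H by blast
    have sub: "verts H \<subseteq> verts H'" "arcs H \<subseteq> arcs H'"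
      using that by (auto simp: subgraph_def)
    have fin: "finite (verts H')" "finite (arcs H')"
      using that(2) finite_verts finite_arcs by (auto simp: subgraph_def intro: finite_subset)
    have "card (verts H) \<le> card (verts H')" "card (arcs H) \<le> card (arcs H')"
      using sub fin by (auto intro: card_mono)
    then have "card (verts H) = card (verts H')" "card (arcs H) = card (arcs H')"
      using le by (auto simp: s_def)
    then have "verts H = verts H'" "arcs H = arcs H'"
      using sub fin by (metis card_subset_eq)+
    moreover have "tail H = tail H'" "head H = head H'"
      using that(1) by (auto simp: subgraph_def compatible_def)
    ultimately show "H' = H"
      by simp
  qed
  then have "H \<in> weak_components G"
    using H unfolding weak_components_def max_subgraph_def P_def by blast
  then show ?thesis
    using H unfolding P_def by blast
qed

lemma connected_star_digraph:
  assumes "a \<in> V" "\<And>v. v \<in> V \<Longrightarrow> v = a \<or> (a, v) \<in> R" "R \<subseteq> V \<times> V"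
  shows "Digraph_Component.connected (with_proj \<lparr>pverts = V, parcs = R\<rparr>)"
proof -
  let ?S = "mk_symmetric (with_proj \<lparr>pverts = V, parcs = R\<rparr>)"
  have S: "?S = \<lparr>pverts = V, parcs = R \<union> R\<inverse>\<rparr>"
    by (auto simp: mk_symmetric_def arcs_ends_conv)
  have sym: "(v, a) \<in> rtrancl_on V (R \<union> R\<inverse>) \<and> (a, v) \<in> rtrancl_on V (R \<union> R\<inverse>)"
    if "v \<in> V" for v
  proof (cases "v = a")
    case False
    then have "(a, v) \<in> R"
      using assms(2) that by blast
    then show ?thesis
      using assms(1) that
      by (auto intro: rtrancl_on_into_rtrancl_on[OF rtrancl_on_refl])
  qed (use that in auto)
  have "(u, v) \<in> rtrancl_on V (R \<union> R\<inverse>)" if "u \<in> V" "v \<in> V" for u v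
    using sym[OF that(1)] sym[OF that(2)] rtrancl_on_trans by metis
  then show ?thesis
    using assms(1) unfolding connected_def strongly_connected_def S reachable_def by auto
qed

text \<open>These three consequences are all that is used about components. For the symmetry, the head and the
  tail of an arc lie in the same weak component, which is strongly connected, so the arc can be
  traversed backwards along a path.\<close>

lemma weak_components_strongly_connected:
  fixes R :: "('n::finite \<times> 'n) set"
  defines "G \<equiv> with_proj \<lparr>pverts = UNIV, parcs = R\<rparr>"
  assumes comp: "\<forall>H \<in> weak_components G. strongly_connected H \<and> card (verts H) \<ge> 2"
    and big: "\<exists>H \<in> weak_components G. card (verts H) \<ge> 3"
  shows "sym (R\<^sup>*)"
    and "\<exists>w. w \<noteq> v \<and> (v, w) \<in> R\<^sup>*"
    and "\<exists>x y z. x \<noteq> y \<and> y \<noteq> z \<and> x \<noteq> z \<and> (x, y) \<in> R\<^sup>* \<and> (x, z) \<in> R\<^sup>*"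
proof -
  have fin: "fin_digraph G"
    by unfold_locales (auto simp: G_def)
  have reach: "(u, v) \<in> R\<^sup>*"
    if H: "H \<in> weak_components G" and uv: "u \<in> verts H" "v \<in> verts H" for H u v
  proof -
    have "subgraph H G"
      using H by (simp add: weak_components_def pre_digraph.max_subgraph_def)
    moreover have "u \<rightarrow>\<^sup>*\<^bsub>H\<^esub> v"
      using comp H uv by (auto simp: strongly_connected_def)
    ultimately have "u \<rightarrow>\<^sup>*\<^bsub>G\<^esub> v"
      using pre_digraph.reachable_mono by metis
    then show ?thesis
      unfolding G_def reachable_with_proj_iff .
  qed
  have wf: "wf_digraph (with_proj \<lparr>pverts = V, parcs = E\<rparr>)" if "E \<subseteq> V \<times> V"
    for V and E :: "('n \<times> 'n) set"
    using that by unfold_locales auto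
  have "(b, a) \<in> R\<^sup>*" if "(a, b) \<in> R" for a b
  proof -
    let ?H0 = "with_proj \<lparr>pverts = {a, b}, parcs = {(a, b)}\<rparr>"
    have "subgraph ?H0 G" "Digraph_Component.connected ?H0"
      using that wf by (auto simp: subgraph_def G_def intro!: connected_star_digraph[of a])
    then obtain H where "H \<in> weak_components G" "subgraph ?H0 H"
      using connected_subgraph_in_weak_component[OF fin] by blast
    then show ?thesis
      using reach[of H b a] by (auto simp: subgraph_def)
  qed
  then have "R\<inverse> \<subseteq> R\<^sup>*"
    by auto
  then have "(R\<inverse>)\<^sup>* \<subseteq> R\<^sup>*"
    by (metis rtrancl_mono rtrancl_idemp)
  then show "sym (R\<^sup>*)"
    by (auto simp: sym_def rtrancl_converse)
  show "\<exists>w. w \<noteq> v \<and> (v, w) \<in> R\<^sup>*"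
  proof -
    let ?H0 = "with_proj \<lparr>pverts = {v}, parcs = {}\<rparr>"
    have "subgraph ?H0 G" "Digraph_Component.connected ?H0"
      using wf by (auto simp: subgraph_def G_def intro!: connected_star_digraph[of v])
    then obtain H where H: "H \<in> weak_components G" "subgraph ?H0 H"
      using connected_subgraph_in_weak_component[OF fin] by blast
    then have "v \<in> verts H" "card (verts H) \<ge> 2"
      using comp by (auto simp: subgraph_def)
    then obtain w where "w \<in> verts H" "w \<noteq> v"
      by (metis card_2_iff' card_le_Suc0_iff_eq card.infinite not_less_eq_eq
          numeral_2_eq_2 zero_le)
    then show ?thesis
      using reach H \<open>v \<in> verts H\<close> by blast
  qed
  obtain H where H: "H \<in> weak_components G" "card (verts H) \<ge> 3"
    using big by blast
  then obtain S where "S \<subseteq> verts H" "card S = 3"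
    using obtain_subset_with_card_n by metis
  then obtain x y z where "x \<in> verts H" "y \<in> verts H" "z \<in> verts H" "x \<noteq> y" "y \<noteq> z" "x \<noteq> z"
    by (auto simp: card_3_iff)
  then show "\<exists>x y z. x \<noteq> y \<and> y \<noteq> z \<and> x \<noteq> z \<and> (x, y) \<in> R\<^sup>* \<and> (x, z) \<in> R\<^sup>*"
    using reach H by blast
qed

section \<open>Lie subalgebras of matrices\<close>

lemma bounded_bilinear_matrix_mult:
  "bounded_bilinear ((**) :: real^'n^'m \<Rightarrow> real^'p^'n \<Rightarrow> real^'p^'m)"
  unfolding bilinear_conv_bounded_bilinear[symmetric] bilinear_def
  by (auto intro!: linearI simp: vec_eq_iff matrix_matrix_mult_def sum.distrib algebra_simps sum_distrib_left)

interpretation mat_mult: bounded_bilinear "(**) :: real^'n^'m \<Rightarrow> real^'p^'n \<Rightarrow> real^'p^'m"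
  by (rule bounded_bilinear_matrix_mult)

definition commutator :: "real^'n^'n \<Rightarrow> real^'n^'n \<Rightarrow> real^'n^'n" where
  "commutator X Y = X ** Y - Y ** X"

lemma E_mat_entry: "E_mat a b $ r $ c = (if r = a \<and> c = b then 1 else 0)"
  by (simp add: E_mat_def)

lemma E_mat_mult_entry: "(E_mat a b ** X) $ r $ c = (if r = a then X $ b $ c else 0)"
  by (simp add: E_mat_entry matrix_matrix_mult_def if_distrib[of "\<lambda>z. z * _"] if_distrib[of "(*) _"]
      sum.delta' cong: if_cong conj_cong)

lemma mult_E_mat_entry: "(X ** E_mat a b) $ r $ c = (if c = b then X $ r $ a else 0)"
  by (auto simp: E_mat_entry matrix_matrix_mult_def if_distrib[of "(*) _"] 
      sum.delta cong: if_cong conj_cong)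

lemma matrix_eq_sum_E_mat: "X = (\<Sum>a\<in>UNIV. \<Sum>b\<in>UNIV. X $ a $ b *\<^sub>R E_mat a b)"
proof -
  have "(\<Sum>a\<in>UNIV. \<Sum>b\<in>UNIV. X $ a $ b * (if r = a \<and> c = b then 1 else 0)) = X $ r $ c" for r c
  proof -
    have "(\<Sum>a\<in>UNIV. \<Sum>b\<in>UNIV. X $ a $ b * (if r = a \<and> c = b then 1 else 0))
        = (\<Sum>a\<in>UNIV. if r = a then \<Sum>b\<in>UNIV. if c = b then X $ a $ b else 0 else 0)"
      by (intro sum.cong) (auto simp: if_distrib[of "(*) _"] cong: if_cong)
    then show ?thesis
      by simp
  qed
  then show ?thesis
    by (simp add: vec_eq_iff E_mat_entry)
qed

lemmas commutator_entry = commutator_def vec_eq_iff E_mat_mult_entry mult_E_mat_entry E_mat_entry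

definition lie_subalgebra :: "(real^'n^'n) set \<Rightarrow> bool" where
  "lie_subalgebra N \<longleftrightarrow> subspace N \<and> (\<forall>X\<in>N. \<forall>Y\<in>N. commutator X Y \<in> N)"

lemma lie_subalgebra_E_mat_trans:
  assumes "lie_subalgebra N" "E_mat a b \<in> N" "E_mat b c \<in> N" "a \<noteq> c"
  shows "E_mat a c \<in> N"
proof -
  have "commutator (E_mat a b) (E_mat b c) = E_mat a c"
    using assms(4) by (auto simp: commutator_entry)
  then show ?thesis
    using assms unfolding lie_subalgebra_def by metis
qed

lemma lie_subalgebra_E_mat_path:
  assumes N: "lie_subalgebra N" and arcs: "\<And>a b. (a, b) \<in> R \<Longrightarrow> E_mat a b \<in> N"
    and "(v, w) \<in> R\<^sup>*" "v \<noteq> w"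
  shows "E_mat v w \<in> N"
  using assms(3,4)
proof (induction rule: rtrancl_induct)
  case (step x y)
  then show ?case
    using arcs lie_subalgebra_E_mat_trans[OF N] by (cases "v = x") auto
qed simp

text \<open>The double bracket with \<open>E_mat c' c\<close> and \<open>E_mat d d'\<close> leaves only two entries of \<open>B\<close>. Bracketing
  with \<open>E_mat c'' c'\<close> on the left, or with \<open>E_mat c c''\<close> on the right, kills one of the two.\<close>

lemma separate_E_mat:
  fixes B :: "real^'n^'n"
  assumes N: "lie_subalgebra N" and B: "B \<in> N"
    and C: "\<And>a b. a \<in> {c, c', c''} \<Longrightarrow> b \<in> {c, c', c''} \<Longrightarrow> a \<noteq> b \<Longrightarrow> E_mat a b \<in> N"
    and dist: "c \<noteq> c'" "c \<noteq> c''" "c' \<noteq> c''"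
    and D: "E_mat d d' \<in> N" "E_mat d' d \<in> N" "d \<noteq> d'" "d \<notin> {c, c', c''}" "d' \<notin> {c, c', c''}"
  shows "B $ c $ d \<noteq> 0 \<Longrightarrow> E_mat c d \<in> N" and "B $ d' $ c' \<noteq> 0 \<Longrightarrow> E_mat d' c' \<in> N"
proof -
  have br: "commutator X Y \<in> N" if "X \<in> N" "Y \<in> N" for X Y
    using N that by (simp add: lie_subalgebra_def)
  have sub: "subspace N"
    using N by (simp add: lie_subalgebra_def)
  have cancel: "X \<in> N" if "r *\<^sub>R X \<in> N" "r \<noteq> 0" for r :: real and X
    using subspace_scale[OF sub that(1), of "1/r"] that(2) by simp
  define Z where "Z = commutator (commutator (E_mat c' c) B) (E_mat d d')"
  have Z: "Z = B $ c $ d *\<^sub>R E_mat c' d' + B $ d' $ c' *\<^sub>R E_mat d c"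
    using dist D unfolding Z_def
    by (auto simp: commutator_entry)
  have "Z \<in> N"
    unfolding Z_def using br C B D dist by simp
  {
    assume nz: "B $ c $ d \<noteq> 0"
    have "commutator (E_mat c'' c') Z = B $ c $ d *\<^sub>R E_mat c'' d'"
      using dist D unfolding Z by (auto simp: commutator_entry)
    then have "E_mat c'' d' \<in> N"
      using br[OF C[of c'' c'] \<open>Z \<in> N\<close>] nz cancel dist by fastforce
    then have "E_mat c'' d \<in> N"
      using lie_subalgebra_E_mat_trans[OF N _ D(2)] D by auto
    then show "E_mat c d \<in> N"
      using lie_subalgebra_E_mat_trans[OF N C[of c c'']] D dist by auto
  next
    assume nz: "B $ d' $ c' \<noteq> 0"
    have "commutator Z (E_mat c c'') = B $ d' $ c' *\<^sub>R E_mat d c''"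
      using dist D unfolding Z by (auto simp: commutator_entry)
    then have "E_mat d c'' \<in> N"
      using br[OF \<open>Z \<in> N\<close> C[of c c'']] nz cancel dist by fastforce
    then have "E_mat d' c'' \<in> N"
      using lie_subalgebra_E_mat_trans[OF N D(2)] D by auto
    then show "E_mat d' c' \<in> N"
      using lie_subalgebra_E_mat_trans[OF N _ C[of c'' c']] D dist by auto
  }
qed


text \<open>A space that is only known to be stable under bracketing with some of its elements need not be a
  Lie algebra, but by the Jacobi identity the elements with this stability property form one.\<close>

lemma lie_subalgebra_normalizer:
  assumes U: "subspace U"
  shows "lie_subalgebra {Z \<in> U. \<forall>X\<in>U. commutator Z X \<in> U}"
  unfolding lie_subalgebra_def
proof (intro conjI ballI)
  let ?N = "{Z \<in> U. \<forall>X\<in>U. commutator Z X \<in> U}"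
  have add: "commutator (Z + Z') X = commutator Z X + commutator Z' X"
    and scale: "commutator (r *\<^sub>R Z) X = r *\<^sub>R commutator Z X" for Z Z' X :: "real^'n^'n" and r
    by (simp_all add: commutator_def mat_mult.add_left mat_mult.add_right mat_mult.scaleR_left
        mat_mult.scaleR_right algebra_simps)
  have zero: "commutator 0 X = 0" for X :: "real^'n^'n"
    by (simp add: commutator_def)
  show "subspace ?N"
    unfolding subspace_def
    by (simp add: add scale zero subspace_0[OF U] subspace_add[OF U] subspace_scale[OF U])
  fix Y Z assume YZ: "Y \<in> ?N" "Z \<in> ?N"
  have jacobi: "commutator (commutator Y Z) X
      = commutator Y (commutator Z X) - commutator Z (commutator Y X)" for X
    by (simp add: commutator_def mat_mult.diff_left mat_mult.diff_right matrix_mul_assoc)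
  show "commutator Y Z \<in> ?N"
    using YZ subspace_diff[OF U] by (auto simp: jacobi)
qed

text \<open>The vertex \<open>c\<close> of a component with at least three vertices serves as a hub: all \<open>E_mat c f\<close> and
  \<open>E_mat f c\<close> are obtained by induction along walks of the union digraph, and then
  \<open>E_mat x y\<close> is the bracket of \<open>E_mat x c\<close> and \<open>E_mat c y\<close>.\<close>

lemma lie_subalgebra_eq_UNIV:
  fixes A :: "real^'n^'n" and R :: "('n \<times> 'n) set"
  assumes N: "lie_subalgebra N" and A: "A \<in> N" and R: "\<And>a b. (a, b) \<in> R \<Longrightarrow> E_mat a b \<in> N"
    and sym: "sym (R\<^sup>*)" and two: "\<And>v. \<exists>w. w \<noteq> v \<and> (v, w) \<in> R\<^sup>*"
    and three: "c \<noteq> c'" "c' \<noteq> c''" "c \<noteq> c''" "(c, c') \<in> R\<^sup>*" "(c, c'') \<in> R\<^sup>*"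
    and conn: "\<And>v w. (v, w) \<in> (R \<union> {(v, w). A $ v $ w \<noteq> 0})\<^sup>*"
    and tr: "(\<exists>v. (v, v) \<in> R) \<or> trace A \<noteq> 0"
  shows "N = UNIV"
proof -
  have br: "commutator X Y \<in> N" if "X \<in> N" "Y \<in> N" for X Y
    using N that by (simp add: lie_subalgebra_def)
  have sub: "subspace N"
    using N by (simp add: lie_subalgebra_def)
  have cancel: "X \<in> N" if "r *\<^sub>R X \<in> N" "r \<noteq> 0" for r :: real and X
    using subspace_scale[OF sub that(1), of "1/r"] that(2) by simp
  note trans = lie_subalgebra_E_mat_trans[OF N]
  have path: "E_mat v w \<in> N" if "(v, w) \<in> R\<^sup>*" "v \<noteq> w" for v w
    using lie_subalgebra_E_mat_path[OF N R that] .
  have symD: "(b, a) \<in> R\<^sup>*" if "(a, b) \<in> R\<^sup>*" for a b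
    using sym that by (auto simp: sym_def)
  have C: "(a, b) \<in> R\<^sup>*" if "a \<in> {c, c', c''}" "b \<in> {c, c', c''}" for a b
    using that three(4,5) symD by (metis insertE rtrancl.rtrancl_refl rtrancl_trans singletonD)
  \<comment> \<open>\<open>separate_E_mat\<close> for a vertex \<open>a\<close> in the component of \<open>c\<close> and a vertex \<open>d\<close> outside: the spare vertices \<open>b\<close>, \<open>b'\<close>
    and \<open>e\<close> exist by the sizes of the two components.\<close>
  have sep: "(B $ a $ d \<noteq> 0 \<longrightarrow> E_mat a d \<in> N) \<and> (B $ d $ a \<noteq> 0 \<longrightarrow> E_mat d a \<in> N)"
    if B: "B \<in> N" and a: "(c, a) \<in> R\<^sup>*" and d: "(c, d) \<notin> R\<^sup>*" for B a d
  proof -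
    have "\<exists>b b'. a \<noteq> b \<and> a \<noteq> b' \<and> b \<noteq> b' \<and> (c, b) \<in> R\<^sup>* \<and> (c, b') \<in> R\<^sup>*"
      using three by (metis rtrancl.rtrancl_refl)
    then obtain b b' where b: "a \<noteq> b" "a \<noteq> b'" "b \<noteq> b'" "(c, b) \<in> R\<^sup>*" "(c, b') \<in> R\<^sup>*"
      by blast
    have Eabs: "E_mat x y \<in> N" if "x \<in> {a, b, b'}" "y \<in> {a, b, b'}" "x \<noteq> y" for x y
      using that a b symD by (intro path) (auto intro: rtrancl_trans)
    obtain e where e: "e \<noteq> d" "(d, e) \<in> R\<^sup>*"
      using two by blast
    have Ede: "E_mat d e \<in> N" "E_mat e d \<in> N"
      using e symD path by metis+
    have notin: "d \<notin> {a, b, b'}" "e \<notin> {a, b, b'}"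
      using a b d e symD by (auto intro: rtrancl_trans)
    have "B $ a $ d \<noteq> 0 \<longrightarrow> E_mat a d \<in> N"
      using separate_E_mat(1)[OF N B, of a b b' d e] Eabs b e Ede notin by metis
    moreover have "B $ d $ a \<noteq> 0 \<longrightarrow> E_mat d a \<in> N"
      using separate_E_mat(2)[OF N B, of b a b' e d] Eabs b e Ede notin
      by (metis insert_commute)
    ultimately show ?thesis ..
  qed
  have out: "E_mat c f \<in> N" if "c \<noteq> f" for f
    using conn[of c f] that
  proof (induction rule: rtrancl_induct)
    case (step d f)
    show ?case
    proof (cases "(c, f) \<in> R\<^sup>*")
      case True
      then show ?thesis
        using path step.prems by blast
    next
      case f: False
      show ?thesis
      proof (cases "d = c \<or> (d, f) \<in> R \<or> d = f")
        case True
        \<comment> \<open>If \<open>d\<close> is the hub, the arc comes from \<open>A\<close>, since a controlled one would keep \<open>f\<close> in the component.\<close>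
        then show ?thesis
          using f step sep[OF A, of c f] trans[of c d f] R[of d f] by auto
      next
        case False
        then have Acd: "E_mat c d \<in> N" and Adf: "A $ d $ f \<noteq> 0" and df: "d \<noteq> f"
          using step by auto
        \<comment> \<open>The arc from \<open>d\<close> to \<open>f\<close> need not touch the hub component; the bracket moves its tail to \<open>c\<close>.\<close>
        have "commutator (E_mat c d) A \<in> N"
          using br Acd A by blast
        moreover have "commutator (E_mat c d) A $ c $ f = A $ d $ f"
          using df by (simp add: commutator_def E_mat_mult_entry mult_E_mat_entry)
        ultimately show ?thesis
          using sep[of "commutator (E_mat c d) A" c f] f Adf by auto
      qed
    qed
  qed simp
  have into: "E_mat d c \<in> N" if "c \<noteq> d" for d
    using conn[of d c] that
  proof (induction rule: converse_rtrancl_induct)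
    case (step d f)
    show ?case
    proof (cases "(c, d) \<in> R\<^sup>*")
      case True
      then show ?thesis
        using path symD step.prems by metis
    next
      case d: False
      show ?thesis
      proof (cases "f = c \<or> (d, f) \<in> R \<or> d = f")
        case True
        then show ?thesis
          using d step sep[OF A, of c d] trans[of d f c] R[of d f] by auto
      next
        case False
        then have Afc: "E_mat f c \<in> N" and Adf: "A $ d $ f \<noteq> 0" and df: "d \<noteq> f"
          using step by auto
        have "commutator A (E_mat f c) \<in> N"
          using br Afc A by blast
        moreover have "commutator A (E_mat f c) $ d $ c = A $ d $ f"
          using df by (simp add: commutator_def E_mat_mult_entry mult_E_mat_entry)
        ultimately show ?thesis
          using sep[of "commutator A (E_mat f c)" c d] d Adf by auto
      qed
    qed
  qed simp
  have off: "E_mat x y \<in> N" if "x \<noteq> y" for x y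
    using that trans[of x c y] out into by metis
  have diag_diff: "E_mat x x - E_mat y y \<in> N" for x y
  proof (cases "x = y")
    case False
    then have "commutator (E_mat x y) (E_mat y x) = E_mat x x - E_mat y y"
      by (auto simp: commutator_entry)
    then show ?thesis
      using br off False by metis
  qed (use sub subspace_0 in auto)
  have diag: "\<exists>v. E_mat v v \<in> N"
    using tr
  proof
    assume tr: "trace A \<noteq> 0"
    \<comment> \<open>Modulo trace-free matrices, \<open>A\<close> is a multiple of \<open>E_mat c c\<close>.\<close>
    define S where "S = (\<Sum>a\<in>UNIV. \<Sum>b\<in>UNIV.
        A $ a $ b *\<^sub>R (if a = b then E_mat a a - E_mat c c else E_mat a b))"
    define D where "D = trace A *\<^sub>R E_mat c c"
    have "A = (\<Sum>a\<in>UNIV. \<Sum>b\<in>UNIV.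
        A $ a $ b *\<^sub>R (if a = b then E_mat a a - E_mat c c else E_mat a b)
        + (if a = b then A $ a $ a *\<^sub>R E_mat c c else 0))"
      by (subst matrix_eq_sum_E_mat[of A]) (intro sum.cong, auto simp: algebra_simps)
    also have "\<dots> = S + D"
      by (simp add: sum.distrib trace_def scaleR_sum_left S_def D_def)
    finally have "D = A - S"
      by simp
    moreover have "S \<in> N"
      unfolding S_def
      using off diag_diff by (intro subspace_sum[OF sub] subspace_scale[OF sub]) auto
    ultimately have "trace A *\<^sub>R E_mat c c \<in> N"
      using A subspace_diff[OF sub] D_def by metis
    then show ?thesis
      using cancel tr by blast
  qed (use R in blast)
  then obtain v where "E_mat v v \<in> N" ..
  then have "E_mat x x \<in> N" for x
    using subspace_add[OF sub diag_diff[of x v]] by fastforce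
  then have all: "E_mat x y \<in> N" for x y
    using off by (cases "x = y") auto
  have "X \<in> N" for X
    by (subst matrix_eq_sum_E_mat) (intro subspace_sum[OF sub] subspace_scale[OF sub] all)
  then show ?thesis
    by blast
qed

section \<open>The matrix exponential\<close>

definition mat_pow :: "real^'n^'n \<Rightarrow> nat \<Rightarrow> real^'n^'n" where
  "mat_pow Y k = (((**) Y) ^^ k) (mat 1)"

text \<open>The exponential of \<open>t Y\<close>, as a matrix of scalar power series in \<open>t\<close>: its derivative
  is then a matter of termwise differentiation in each entry.\<close>

definition mat_exp :: "real^'n^'n \<Rightarrow> real \<Rightarrow> real^'n^'n" where
  "mat_exp Y t = (\<chi> a b. \<Sum>k. mat_pow Y k $ a $ b / fact k * t ^ k)"

lemma mat_pow_0 [simp]: "mat_pow Y 0 = mat 1"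
  by (simp add: mat_pow_def)

lemma mat_pow_Suc: "mat_pow Y (Suc k) = Y ** mat_pow Y k"
  by (simp add: mat_pow_def)

lemma mat_pow_Suc2: "mat_pow Y (Suc k) = mat_pow Y k ** Y"
  by (induction k) (metis mat_pow_0 mat_pow_Suc matrix_mul_lid matrix_mul_rid,
      metis mat_pow_Suc matrix_mul_assoc)

text \<open>A crude bound, but geometric in \<open>k\<close>, which is what makes the exponential series converge
  everywhere.\<close>

lemma mat_pow_entry_bound:
  "\<bar>mat_pow Y k $ a $ b\<bar> \<le> (\<Sum>r\<in>UNIV. \<Sum>c\<in>UNIV. \<bar>Y $ r $ c\<bar>) ^ k" (is "_ \<le> ?M ^ k")
proof (induction k arbitrary: a b)
  case 0
  then show ?case
    by (simp add: mat_def)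
next
  case (Suc k)
  have nn: "0 \<le> ?M"
    by (intro sum_nonneg) auto
  have row: "(\<Sum>c\<in>UNIV. \<bar>Y $ a $ c\<bar>) \<le> ?M"
    by (rule member_le_sum[where f = "\<lambda>r. \<Sum>c\<in>UNIV. \<bar>Y $ r $ c\<bar>"]) (auto intro: sum_nonneg)
  have "\<bar>mat_pow Y (Suc k) $ a $ b\<bar> = \<bar>\<Sum>c\<in>UNIV. Y $ a $ c * mat_pow Y k $ c $ b\<bar>"
    by (simp add: mat_pow_Suc matrix_matrix_mult_def)
  also have "\<dots> \<le> (\<Sum>c\<in>UNIV. \<bar>Y $ a $ c\<bar> * \<bar>mat_pow Y k $ c $ b\<bar>)"
    by (rule order_trans[OF sum_abs]) (simp add: abs_mult)
  also have "\<dots> \<le> (\<Sum>c\<in>UNIV. \<bar>Y $ a $ c\<bar> * ?M ^ k)"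
    by (intro sum_mono mult_left_mono Suc) auto
  also have "\<dots> = (\<Sum>c\<in>UNIV. \<bar>Y $ a $ c\<bar>) * ?M ^ k"
    by (simp add: sum_distrib_right)
  also have "\<dots> \<le> ?M * ?M ^ k"
    by (intro mult_right_mono row) (simp add: nn)
  finally show ?case
    by simp
qed

lemma summable_mat_exp: "summable (\<lambda>k. mat_pow Y k $ a $ b / fact k * t ^ k)"
proof (rule summable_comparison_test'[where N = 0])
  let ?M = "\<Sum>r\<in>UNIV. \<Sum>c\<in>UNIV. \<bar>Y $ r $ c\<bar>"
  show "summable (\<lambda>k. inverse (fact k) * (?M * \<bar>t\<bar>) ^ k)"
    by (rule summable_exp)
  fix k
  show "norm (mat_pow Y k $ a $ b / fact k * t ^ k) \<le> inverse (fact k) * (?M * \<bar>t\<bar>) ^ k"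
    using mult_right_mono[OF mat_pow_entry_bound[of Y k a b], of "\<bar>t\<bar> ^ k / fact k"]
    by (simp add: abs_mult power_abs power_mult_distrib divide_inverse mult_ac)
qed

lemma mat_exp_0 [simp]: "mat_exp Y 0 = mat 1"
proof -
  have "(\<Sum>k. mat_pow Y k $ a $ b / fact k * 0 ^ k) = mat 1 $ a $ b" for a b
    by (subst powser_zero) simp
  then show ?thesis
    by (simp add: mat_exp_def vec_eq_iff del: times_divide_eq_left)
qed

lemma has_vector_derivative_matrixI:
  fixes X :: "real \<Rightarrow> real^'n^'n"
  assumes "\<And>a b. ((\<lambda>t. X t $ a $ b) has_vector_derivative D $ a $ b) F"
  shows "(X has_vector_derivative D) F"
proof -
  have "((\<lambda>t. \<Sum>a\<in>UNIV. \<Sum>b\<in>UNIV. X t $ a $ b *\<^sub>R E_mat a b) has_vector_derivative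
      (\<Sum>a\<in>UNIV. \<Sum>b\<in>UNIV. D $ a $ b *\<^sub>R E_mat a b)) F"
    by (intro has_vector_derivative_sum bounded_linear.has_vector_derivative[OF bounded_linear_scaleR_left] assms)
  then show ?thesis
    by (simp flip: matrix_eq_sum_E_mat)
qed

lemma has_vector_derivative_mat_exp_series:
  "(mat_exp Y has_vector_derivative (\<chi> a b. \<Sum>k. mat_pow Y (Suc k) $ a $ b / fact k * t ^ k)) (at t)"
proof -
  have "((\<lambda>t. mat_exp Y t $ a $ b) has_vector_derivative (\<Sum>k. mat_pow Y (Suc k) $ a $ b / fact k * t ^ k)) (at t)"
    for a b
  proof -
    have "diffs (\<lambda>k. mat_pow Y k $ a $ b / fact k) = (\<lambda>k. mat_pow Y (Suc k) $ a $ b / fact k)"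
      by (simp add: diffs_def fun_eq_iff del: of_nat_Suc)
    then show ?thesis
      using termdiffs_strong_converges_everywhere[of "\<lambda>k. mat_pow Y k $ a $ b / fact k" t]
        summable_mat_exp[of Y a b]
      by (simp add: mat_exp_def has_real_derivative_iff_has_vector_derivative)
  qed
  then show ?thesis
    by (intro has_vector_derivative_matrixI) simp
qed

lemma has_vector_derivative_mat_exp:
  "(mat_exp Y has_vector_derivative Y ** mat_exp Y t) (at t)"
  "(mat_exp Y has_vector_derivative mat_exp Y t ** Y) (at t)"
proof -
  have "(\<chi> a b. \<Sum>k. mat_pow Y (Suc k) $ a $ b / fact k * t ^ k) = Y ** mat_exp Y t"
  proof -
    have "(\<Sum>k. mat_pow Y (Suc k) $ a $ b / fact k * t ^ k) = (\<Sum>c\<in>UNIV. Y $ a $ c * mat_exp Y t $ c $ b)" for a b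
    proof -
      have "(\<Sum>k. mat_pow Y (Suc k) $ a $ b / fact k * t ^ k)
          = (\<Sum>k. \<Sum>c\<in>UNIV. Y $ a $ c * (mat_pow Y k $ c $ b / fact k * t ^ k))"
        by (simp add: mat_pow_Suc matrix_matrix_mult_def sum_divide_distrib sum_distrib_right mult.assoc)
      then show ?thesis
        by (simp only: mat_exp_def vec_lambda_beta suminf_sum suminf_mult summable_mat_exp
            summable_mult[OF summable_mat_exp])
    qed
    then show ?thesis
      by (simp add: vec_eq_iff matrix_matrix_mult_def)
  qed
  then show "(mat_exp Y has_vector_derivative Y ** mat_exp Y t) (at t)"
    using has_vector_derivative_mat_exp_series[of Y t] by simp
  have "(\<chi> a b. \<Sum>k. mat_pow Y (Suc k) $ a $ b / fact k * t ^ k) = mat_exp Y t ** Y"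
  proof -
    have "(\<Sum>k. mat_pow Y (Suc k) $ a $ b / fact k * t ^ k) = (\<Sum>c\<in>UNIV. mat_exp Y t $ a $ c * Y $ c $ b)" for a b
    proof -
      have "(\<Sum>k. mat_pow Y (Suc k) $ a $ b / fact k * t ^ k)
          = (\<Sum>k. \<Sum>c\<in>UNIV. mat_pow Y k $ a $ c / fact k * t ^ k * Y $ c $ b)"
        by (simp add: mat_pow_Suc2 matrix_matrix_mult_def sum_divide_distrib sum_distrib_right
            sum_distrib_left mult_ac)
      then show ?thesis
        by (simp only: mat_exp_def vec_lambda_beta suminf_sum suminf_mult2 summable_mat_exp
            summable_mult2[OF summable_mat_exp])
    qed
    then show ?thesis
      by (simp add: vec_eq_iff matrix_matrix_mult_def)
  qed
  then show "(mat_exp Y has_vector_derivative mat_exp Y t ** Y) (at t)"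
    using has_vector_derivative_mat_exp_series[of Y t] by simp
qed

lemma mat_exp_commute: "Y ** mat_exp Y t = mat_exp Y t ** Y"
  using has_vector_derivative_mat_exp vector_derivative_unique_at by blast

lemma continuous_on_mat_exp [continuous_intros]:
  "continuous_on S f \<Longrightarrow> continuous_on S (\<lambda>x. mat_exp Y (f x))"
  using continuous_on_compose2[of UNIV "mat_exp Y" S f] has_vector_derivative_mat_exp(1)
    continuous_at_imp_continuous_on has_vector_derivative_continuous by blast

lemma mat_exp_backward_derivative:
  "((\<lambda>t. mat_exp Y (a - t)) has_vector_derivative - (mat_exp Y (a - t) ** Y)) (at t within S)"
proof -
  have "((\<lambda>t. a - t) has_vector_derivative - 1) (at t within S)"
    by (auto intro!: derivative_eq_intros)
  from vector_diff_chain_within[OF this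
      has_vector_derivative_at_within[OF has_vector_derivative_mat_exp(2)[of Y "a - t"]]]
  show ?thesis
    by (simp add: o_def)
qed

text \<open>The curve \<open>mat_exp Y (b - t) ** X t\<close> has derivative zero, hence the same value at both ends.\<close>

lemma linear_ode_unique:
  assumes ab: "a \<le> b" and cont: "continuous_on {a..b} X"
    and K: "finite K"
    and ode: "\<And>t. t \<in> {a..b} - K \<Longrightarrow> (X has_vector_derivative Y ** X t) (at t within {a..b})"
  shows "X b = mat_exp Y (b - a) ** X a"
proof -
  let ?f = "\<lambda>t. mat_exp Y (b - t) ** X t"
  have "?f b = ?f a"
  proof (rule has_derivative_zero_unique_strong_convex[where f = ?f and c = a, OF _ K])
    show "continuous_on {a..b} ?f"
      by (intro mat_mult.continuous_on continuous_intros cont)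
    fix t assume t: "t \<in> {a..b} - K"
    have "(?f has_vector_derivative mat_exp Y (b - t) ** (Y ** X t) + - (mat_exp Y (b - t) ** Y) ** X t)
        (at t within {a..b})"
      by (intro mat_mult.has_vector_derivative ode t mat_exp_backward_derivative)
    then show "(?f has_derivative (\<lambda>h. 0)) (at t within {a..b})"
      by (simp add: has_vector_derivative_def mat_mult.minus_left matrix_mul_assoc)
  qed (use ab in auto)
  then show ?thesis
    by simp
qed

text \<open>The curve \<open>mat_exp Y (s + t - r) ** mat_exp Y r\<close> in \<open>r\<close> has derivative zero; compare \<open>r = t\<close> with
  \<open>r = 0\<close>.\<close>

lemma mat_exp_add: "mat_exp Y (s + t) = mat_exp Y s ** mat_exp Y t"
proof -
  let ?f = "\<lambda>r. mat_exp Y (s + t - r) ** mat_exp Y r"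
  have "?f t = ?f 0"
  proof (rule has_derivative_zero_unique_strong_convex[where f = ?f and c = 0, OF convex_UNIV finite.emptyI])
    show "continuous_on UNIV ?f"
      by (intro mat_mult.continuous_on continuous_intros)
    fix r :: real
    have "(?f has_vector_derivative
        mat_exp Y (s + t - r) ** (Y ** mat_exp Y r) + - (mat_exp Y (s + t - r) ** Y) ** mat_exp Y r) (at r)"
      by (intro mat_mult.has_vector_derivative has_vector_derivative_mat_exp mat_exp_backward_derivative)
    then show "(?f has_derivative (\<lambda>h. 0)) (at r)"
      by (simp add: has_vector_derivative_def mat_mult.minus_left matrix_mul_assoc)
  qed auto
  then show ?thesis
    by simp
qed

lemma mat_exp_minus: "mat_exp Y (- t) ** mat_exp Y t = mat 1"
  using mat_exp_add[of Y "- t" t] by simp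

lemma mat_exp_minus': "mat_exp Y t ** mat_exp Y (- t) = mat 1"
  using mat_exp_minus[of Y "- t"] by simp

lemma invertible_mat_exp: "invertible (mat_exp Y t)"
  using mat_exp_minus mat_exp_minus' unfolding invertible_def by blast

section \<open>The reachable set as a semigroup of exponentials\<close>

inductive_set flow_semigroup :: "(real^'n^'n) set \<Rightarrow> (real^'n^'n) set" for F where
  one: "mat 1 \<in> flow_semigroup F"
| step: "g \<in> flow_semigroup F \<Longrightarrow> Y \<in> F \<Longrightarrow> 0 \<le> s \<Longrightarrow> mat_exp Y s ** g \<in> flow_semigroup F"

lemma invertible_flow_semigroup: "g \<in> flow_semigroup F \<Longrightarrow> invertible g"
  by (induction rule: flow_semigroup.induct)
    (auto simp: invertible_mat_exp invertible_mult invertible_def[of "mat 1"] intro!: exI[of _ "mat 1"])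

definition control_family :: "real^'n^'n \<Rightarrow> nat \<Rightarrow> (nat \<Rightarrow> 'n) \<Rightarrow> (nat \<Rightarrow> 'n) \<Rightarrow> (real^'n^'n) set" where
  "control_family A m i j = range (\<lambda>c. A + (\<Sum>k = 1..m. c k *\<^sub>R E_mat (i k) (j k)))"

lemma mat_1_in_GL_plus: "mat 1 \<in> GL_plus"
  unfolding GL_plus_def by (auto simp: invertible_def intro!: exI[of _ "mat 1"])

lemma connected_subset_GL_plus:
  assumes "Topological_Spaces.connected S" "x \<in> S" "x \<in> GL_plus" "\<And>X. X \<in> S \<Longrightarrow> invertible X"
  shows "S \<subseteq> GL_plus"
proof -
  have "GL_plus = connected_component_set {X. invertible X} x"
    using assms(3) unfolding GL_plus_def by (metis connected_component_eq)
  then show ?thesis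
    using connected_component_maximal[of x S "{X. invertible X}"] assms by auto
qed

lemma open_GL_plus: "open GL_plus"
proof -
  have "continuous_on UNIV (det :: real^'n^'n \<Rightarrow> real)"
    unfolding det_def[abs_def] by (intro continuous_intros)
  then have "open {X :: real^'n^'n. det X \<noteq> 0}"
    by (rule open_Collect_neq[OF _ continuous_on_const])
  then show ?thesis
    unfolding GL_plus_def invertible_det_nz by (rule open_connected_component)
qed

lemma piecewise_constant_extend:
  assumes "piecewise_constant T u" "0 \<le> s"
  shows "piecewise_constant (T + s) (\<lambda>t. if t \<le> T then u t else c)"
proof -
  obtain S where S: "finite S" "\<And>a b. {a<..<b} \<subseteq> {0..T} - S \<Longrightarrow> u constant_on {a<..<b}"
    using assms(1) by (auto simp: piecewise_constant_def)
  let ?u = "\<lambda>t. if t \<le> T then u t else c"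
  have "?u constant_on {a<..<b}" if ab: "{a<..<b} \<subseteq> {0..T + s} - insert T S" for a b
  proof (cases "b \<le> T \<or> b \<le> a")
    case True
    then have "{a<..<b} \<subseteq> {0..T} - S"
      using ab by auto
    then obtain y where "\<forall>t\<in>{a<..<b}. u t = y"
      using S(2) unfolding constant_on_def by blast
    then show ?thesis
      using True unfolding constant_on_def by auto
  next
    case False
    have "T \<notin> {a<..<b}"
      using ab by blast
    then have "\<forall>t\<in>{a<..<b}. ?u t = c"
      using False by auto
    then show ?thesis
      unfolding constant_on_def by blast
  qed
  moreover have "finite (insert T S)"
    using S by simp
  ultimately show ?thesis
    unfolding piecewise_constant_def by blast
qed

lemma reachable_atE:
  assumes "g \<in> reachable_at A m i j T"
  obtains u X S where "\<And>k. k \<in> {1..m} \<Longrightarrow> piecewise_constant T (u k)"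
    and "continuous_on {0..T} X" "X ` {0..T} \<subseteq> GL_plus" "X 0 = mat 1" "g = X T" "finite S"
    and "\<And>t. t \<in> {0..T} - S \<Longrightarrow> (X has_vector_derivative
           A ** X t + (\<Sum>k = 1..m. u k t *\<^sub>R E_mat (i k) (j k)) ** X t) (at t within {0..T})"
proof -
  obtain X u where "g = X T" "trajectory A m i j u T X" "\<forall>k \<in> {1..m}. piecewise_constant T (u k)"
    using assms by (auto simp: reachable_at_def)
  then show ?thesis
    using that[of u X] unfolding trajectory_def by blast
qed

text \<open>Continue a trajectory with constant controls for a further time \<open>s\<close>. The switching time \<open>T\<close> joins
  the exceptional set, and the curve stays in \<open>GL_plus\<close> because its new part is a connected set of
  invertible matrices that starts there.\<close>

lemma reachable_at_extend:
  assumes g: "g \<in> reachable_at A m i j T" and T: "0 \<le> T" and s: "0 \<le> s"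
    and Y: "Y = A + (\<Sum>k = 1..m. c k *\<^sub>R E_mat (i k) (j k))"
  shows "mat_exp Y s ** g \<in> reachable_at A m i j (T + s)"
proof -
  obtain u X S where u: "\<And>k. k \<in> {1..m} \<Longrightarrow> piecewise_constant T (u k)"
    and X: "continuous_on {0..T} X" "X ` {0..T} \<subseteq> GL_plus" "X 0 = mat 1" "g = X T" "finite S"
    and ode: "\<And>t. t \<in> {0..T} - S \<Longrightarrow> (X has_vector_derivative
              A ** X t + (\<Sum>k = 1..m. u k t *\<^sub>R E_mat (i k) (j k)) ** X t) (at t within {0..T})"
    by (rule reachable_atE[OF g], rule that)
  define u' where "u' k t = (if t \<le> T then u k t else c k)" for k t
  define Z where "Z t = mat_exp Y (t - T) ** X T" for t
  define X' where "X' t = (if t \<le> T then X t else Z t)" for t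
  have contZ: "continuous_on U Z" for U
    unfolding Z_def by (intro mat_mult.continuous_on continuous_intros)
  have Zdot: "(Z has_vector_derivative Y ** Z t) (at t within U)" for t U
  proof -
    have "((\<lambda>t. t - T) has_vector_derivative 1) (at t within U)"
      by (auto intro!: derivative_eq_intros)
    from vector_diff_chain_within[OF this
        has_vector_derivative_at_within[OF has_vector_derivative_mat_exp(1)[of Y "t - T"]]]
    have "((\<lambda>t. mat_exp Y (t - T)) has_vector_derivative Y ** mat_exp Y (t - T)) (at t within U)"
      by (simp add: o_def)
    from mat_mult.has_vector_derivative[OF this has_vector_derivative_const[of "X T"]]
    show ?thesis
      by (simp add: Z_def[abs_def] matrix_mul_assoc)
  qed
  have cont: "continuous_on {0..T + s} X'"
    unfolding X'_def
  proof (rule continuous_on_cases_le)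
    show "continuous_on {t \<in> {0..T + s}. t \<le> T} X"
      by (rule continuous_on_subset[OF X(1)]) auto
    show "continuous_on {t \<in> {0..T + s}. T \<le> t} Z"
      by (rule contZ)
  qed (auto simp: Z_def)
  have "X' ` {0..T} \<subseteq> GL_plus"
    using X(2) by (auto simp: X'_def)
  moreover have "Z ` {T..T + s} \<subseteq> GL_plus"
  proof (rule connected_subset_GL_plus)
    show "Topological_Spaces.connected (Z ` {T..T + s})"
      by (rule connected_continuous_image[OF contZ]) simp
    show "X T \<in> Z ` {T..T + s}"
      using s by (auto simp: Z_def intro!: image_eqI[of _ _ T])
    show "X T \<in> GL_plus"
      using X(2) T by auto
    then have "invertible (X T)"
      unfolding GL_plus_def using connected_component_subset by blast
    then show "invertible B" if "B \<in> Z ` {T..T + s}" for B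
      using that by (auto simp: Z_def invertible_mult invertible_mat_exp)
  qed
  ultimately have "X' ` {0..T + s} \<subseteq> GL_plus"
    by (force simp: X'_def)
  moreover have "(X' has_vector_derivative
      A ** X' t + (\<Sum>k = 1..m. u' k t *\<^sub>R E_mat (i k) (j k)) ** X' t) (at t within {0..T + s})"
    if t: "t \<in> {0..T + s} - insert T S" for t
  proof (cases "t < T")
    case True
    have "at t within {0..T + s} = at t within {0..T}"
      using True s by (intro at_within_nhd[of t "{..<T}"]) auto
    moreover have "(X has_vector_derivative
        A ** X' t + (\<Sum>k = 1..m. u' k t *\<^sub>R E_mat (i k) (j k)) ** X' t) (at t within {0..T})"
      using ode[of t] t True by (simp add: X'_def u'_def)
    ultimately show ?thesis
      using True t by (auto intro!: has_vector_derivative_transform_within[where f = X and d = "T - t"]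
          simp: X'_def dist_real_def)
  next
    case False
    then have "T < t"
      using t by auto
    have "(Z has_vector_derivative
        A ** X' t + (\<Sum>k = 1..m. u' k t *\<^sub>R E_mat (i k) (j k)) ** X' t) (at t within {0..T + s})"
      using Zdot[of t] \<open>T < t\<close> by (simp add: X'_def u'_def Y mat_mult.add_left)
    then show ?thesis
      using \<open>T < t\<close> t by (auto intro!: has_vector_derivative_transform_within[where f = Z and d = "t - T"]
          simp: X'_def dist_real_def)
  qed
  moreover have "X' 0 = mat 1"
    using X T by (simp add: X'_def)
  ultimately have "trajectory A m i j u' (T + s) X'"
    unfolding trajectory_def using cont X(5)
    by (intro conjI exI[of _ "insert T S"] ballI) auto
  moreover have "piecewise_constant (T + s) (u' k)" if "k \<in> {1..m}" for k
    unfolding u'_def using piecewise_constant_extend[OF u[OF that] s] by simp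
  moreover have "mat_exp Y s ** g = X' (T + s)"
    using s X(4) by (cases "s = 0") (auto simp: X'_def Z_def)
  ultimately show ?thesis
    unfolding reachable_at_def by blast
qed

text \<open>Subdivide at the exceptional points: each split at such a point lowers the number of exceptional
  points in the interior of both halves.\<close>

lemma interval_induct_finite_exceptions:
  fixes P :: "real \<Rightarrow> bool"
  assumes S: "finite S" and T: "0 \<le> T" and "P 0"
    and step: "\<And>a b. 0 \<le> a \<Longrightarrow> a \<le> b \<Longrightarrow> b \<le> T \<Longrightarrow> {a<..<b} \<inter> S = {} \<Longrightarrow> P a \<Longrightarrow> P b"
  shows "P T"
proof -
  have "P b" if "0 \<le> a" "a \<le> b" "b \<le> T" "P a" for a b
    using that
  proof (induction "card (S \<inter> {a<..<b})" arbitrary: a b rule: less_induct)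
    case less
    show ?case
    proof (cases "{a<..<b} \<inter> S = {}")
      case False
      then obtain c where c: "a < c" "c < b" "c \<in> S"
        by auto
      have "card (S \<inter> {a<..<c}) < card (S \<inter> {a<..<b})" "card (S \<inter> {c<..<b}) < card (S \<inter> {a<..<b})"
        using c S by (auto intro!: psubset_card_mono)
      then show ?thesis
        using less c by (meson less_eq_real_def order_trans)
    qed (use less step in blast)
  qed
  then show ?thesis
    using T \<open>P 0\<close> by blast
qed

text \<open>Between two consecutive switching or exceptional times all controls are constant, and the equation
  is linear with constant coefficients.\<close>

theorem reachable_set_eq_flow_semigroup:
  "reachable_set A m i j = flow_semigroup (control_family A m i j)"
proof (intro equalityI subsetI)
  fix g assume "g \<in> flow_semigroup (control_family A m i j)"
  then show "g \<in> reachable_set A m i j"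
  proof (induction rule: flow_semigroup.induct)
    case one
    have "trajectory A m i j (\<lambda>_ _. 0) 0 (\<lambda>_. mat 1)"
      by (auto simp: trajectory_def mat_1_in_GL_plus intro!: exI[of _ "{0}"])
    moreover have "piecewise_constant 0 (\<lambda>_. 0)"
      by (auto simp: piecewise_constant_def constant_on_def)
    ultimately have "mat 1 \<in> reachable_at A m i j 0"
      unfolding reachable_at_def
      by (intro CollectI exI[of _ "\<lambda>_. mat 1"] exI[of _ "\<lambda>_ _. 0"]) auto
    then show ?case
      unfolding reachable_set_def by force
  next
    case (step g Y s)
    then obtain T c where "0 \<le> T" "g \<in> reachable_at A m i j T"
      "Y = A + (\<Sum>k = 1..m. c k *\<^sub>R E_mat (i k) (j k))"
      by (auto simp: reachable_set_def control_family_def)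
    then have "mat_exp Y s ** g \<in> reachable_at A m i j (T + s)"
      using reachable_at_extend \<open>0 \<le> s\<close> by blast
    then show ?case
      using \<open>0 \<le> T\<close> \<open>0 \<le> s\<close> unfolding reachable_set_def by force
  qed
next
  fix g assume "g \<in> reachable_set A m i j"
  then obtain T where T: "0 \<le> T" "g \<in> reachable_at A m i j T"
    by (auto simp: reachable_set_def)
  obtain u X S where u: "\<And>k. k \<in> {1..m} \<Longrightarrow> piecewise_constant T (u k)"
    and X: "continuous_on {0..T} X" "X ` {0..T} \<subseteq> GL_plus" "X 0 = mat 1" "g = X T" "finite S"
    and ode: "\<And>t. t \<in> {0..T} - S \<Longrightarrow> (X has_vector_derivative
              A ** X t + (\<Sum>k = 1..m. u k t *\<^sub>R E_mat (i k) (j k)) ** X t) (at t within {0..T})"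
    by (rule reachable_atE[OF T(2)], rule that)
  obtain D where D: "\<And>k. k \<in> {1..m} \<Longrightarrow> finite (D k)"
    "\<And>k a b. k \<in> {1..m} \<Longrightarrow> {a<..<b} \<subseteq> {0..T} - D k \<Longrightarrow> u k constant_on {a<..<b}"
    using u unfolding piecewise_constant_def by metis
  have "X T \<in> flow_semigroup (control_family A m i j)"
  proof (rule interval_induct_finite_exceptions[where S = "S \<union> (\<Union>k\<in>{1..m}. D k)" and T = T])
    show "finite (S \<union> (\<Union>k\<in>{1..m}. D k))"
      using X D by auto
    show "0 \<le> T"
      by (fact T)
    show "X 0 \<in> flow_semigroup (control_family A m i j)"
      using X by (simp add: flow_semigroup.one)
    fix a b
    assume ab: "0 \<le> a" "a \<le> b" "b \<le> T" "{a<..<b} \<inter> (S \<union> (\<Union>k\<in>{1..m}. D k)) = {}"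
      and Xa: "X a \<in> flow_semigroup (control_family A m i j)"
    have "\<exists>c. \<forall>t\<in>{a<..<b}. u k t = c" if "k \<in> {1..m}" for k
    proof -
      have "{a<..<b} \<subseteq> {0..T} - D k"
        using ab that by auto
      then show ?thesis
        using D(2)[OF that] by (simp add: constant_on_def)
    qed
    then obtain c where c: "\<And>k t. k \<in> {1..m} \<Longrightarrow> t \<in> {a<..<b} \<Longrightarrow> u k t = c k"
      by metis
    define Y where "Y = A + (\<Sum>k = 1..m. c k *\<^sub>R E_mat (i k) (j k))"
    have "X b = mat_exp Y (b - a) ** X a"
    proof (rule linear_ode_unique[where K = "{a, b}"])
      show "continuous_on {a..b} X"
        using X(1) by (rule continuous_on_subset) (use ab in auto)
      fix t assume t: "t \<in> {a..b} - {a, b}"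
      then have "t \<in> {a<..<b}"
        by auto
      then have "t \<notin> S"
        using ab(4) by blast
      have "(X has_vector_derivative A ** X t + (\<Sum>k = 1..m. u k t *\<^sub>R E_mat (i k) (j k)) ** X t)
             (at t within {a..b})"
        by (rule has_vector_derivative_within_subset[OF ode]) (use t ab \<open>t \<notin> S\<close> in auto)
      moreover have "(\<Sum>k = 1..m. u k t *\<^sub>R E_mat (i k) (j k)) = (\<Sum>k = 1..m. c k *\<^sub>R E_mat (i k) (j k))"
        using c t by (intro sum.cong) auto
      ultimately show "(X has_vector_derivative Y ** X t) (at t within {a..b})"
        by (simp add: Y_def mat_mult.add_left)
    qed (use ab in auto)
    moreover have "Y \<in> control_family A m i j"
      unfolding Y_def control_family_def by blast
    ultimately show "X b \<in> flow_semigroup (control_family A m i j)"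
      using Xa ab by (simp add: flow_semigroup.step)
  qed
  then show "g \<in> flow_semigroup (control_family A m i j)"
    using X by simp
qed

section \<open>Invariants of the reachable set\<close>

lemma flow_semigroup_block_zero:
  fixes g :: "real^'n^'n"
  assumes F: "\<And>Y a b. Y \<in> F \<Longrightarrow> a \<in> V \<Longrightarrow> b \<notin> V \<Longrightarrow> Y $ a $ b = 0"
    and g: "g \<in> flow_semigroup F" and ab: "a \<in> V" "b \<notin> V"
  shows "g $ a $ b = 0"
proof -
  define Bl where "Bl X \<longleftrightarrow> (\<forall>a\<in>V. \<forall>b. b \<notin> V \<longrightarrow> X $ a $ b = 0)" for X :: "real^'n^'n"
  have one: "Bl (mat 1)"
    by (auto simp: Bl_def mat_def)
  have mult: "Bl (X ** Y)" if "Bl X" "Bl Y" for X Y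
    unfolding Bl_def matrix_matrix_mult_def
  proof (intro ballI allI impI)
    fix a b assume "a \<in> V" "b \<notin> V"
    then have zero: "X $ a $ c * Y $ c $ b = 0" for c
      using that unfolding Bl_def by (cases "c \<in> V") auto
    show "(\<chi> i j. \<Sum>k\<in>UNIV. X $ i $ k * Y $ k $ j) $ a $ b = 0"
      by (simp only: vec_lambda_beta zero sum.neutral_const)
  qed
  have "Bl (mat_pow Y k)" if "Bl Y" for Y k
    by (induction k) (simp_all add: one mat_pow_Suc mult that)
  then have exp: "Bl (mat_exp Y s)" if "Bl Y" for Y s
    using that by (simp add: Bl_def mat_exp_def)
  have fam: "Bl Y" if "Y \<in> F" for Y
    using F that by (auto simp: Bl_def)
  from g have "Bl g"
    by (induction rule: flow_semigroup.induct) (simp_all add: one mult exp fam)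
  then show ?thesis
    using ab by (auto simp: Bl_def)
qed

text \<open>In the Leibniz expansion only the identity permutation contributes to first order at the identity
  matrix.\<close>

lemma det_has_derivative_at_mat_1:
  fixes X :: "real \<Rightarrow> real^'n^'n"
  assumes X0: "X t = mat 1"
    and X: "\<And>a b. ((\<lambda>t. X t $ a $ b) has_real_derivative D $ a $ b) (at t)"
  shows "((\<lambda>t. det (X t)) has_real_derivative trace D) (at t)"
proof -
  let ?P = "{p :: 'n \<Rightarrow> 'n. p permutes UNIV}"
  let ?d = "\<lambda>p. of_int (sign p) * (\<Sum>a\<in>UNIV. D $ a $ p a * (\<Prod>b\<in>UNIV - {a}. X t $ b $ p b))"
  have "((\<lambda>t. det (X t)) has_real_derivative (\<Sum>p\<in>?P. ?d p)) (at t)"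
    unfolding det_def by (intro DERIV_sum DERIV_cmult has_field_derivative_prod X)
  also have "(\<Sum>p\<in>?P. ?d p) = (\<Sum>p\<in>?P. if p = id then trace D else 0)"
  proof (rule sum.cong[OF refl])
    fix p assume p: "p \<in> ?P"
    show "?d p = (if p = id then trace D else 0)"
    proof (cases "p = id")
      case True
      then show ?thesis
        by (simp add: X0 mat_def trace_def)
    next
      case False
      \<comment> \<open>A permutation other than the identity moves two points, and the product leaves out only one of them.\<close>
      have zero: "(\<Prod>b\<in>UNIV - {a}. X t $ b $ p b) = 0" for a
      proof -
        obtain c where c: "p c \<noteq> c"
          using False by (auto simp: fun_eq_iff)
        have "p (p c) \<noteq> p c"
          using c p permutes_inj[of p UNIV] by (auto dest: injD)
        then obtain b where "b \<noteq> a" "p b \<noteq> b"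
          using c by metis
        then show ?thesis
          by (intro prod_zero) (auto simp: X0 mat_def intro!: bexI[of _ b])
      qed
      show ?thesis
        using False by (simp only: zero mult_zero_right sum.neutral_const if_False)
    qed
  qed
  also have "\<dots> = trace D"
    by (simp add: finite_permutations permutes_id)
  finally show ?thesis .
qed

text \<open>The special case of Liouville's formula that is needed: multiplicativity of the determinant moves the
  derivative from \<open>t\<close> to \<open>0\<close>, where it is the trace.\<close>

lemma det_mat_exp_trace_0:
  fixes Y :: "real^'n^'n"
  assumes "trace Y = 0"
  shows "det (mat_exp Y t) = 1"
proof -
  have "((\<lambda>t. det (mat_exp Y t)) has_real_derivative 0) (at t)" for t
  proof -
    have "((\<lambda>r. mat_exp Y r $ a $ b) has_real_derivative Y $ a $ b) (at 0)" for a b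
    proof -
      have "bounded_linear (\<lambda>Z::real^'n^'n. Z $ a $ b)"
        by (rule bounded_linear_compose[OF bounded_linear_vec_nth bounded_linear_vec_nth])
      from bounded_linear.has_vector_derivative[OF this has_vector_derivative_mat_exp(1)[of Y 0]]
      show ?thesis
        by (simp add: has_real_derivative_iff_has_vector_derivative)
    qed
    then have "((\<lambda>r. det (mat_exp Y r)) has_real_derivative 0) (at (t - t))"
      using det_has_derivative_at_mat_1[of "mat_exp Y" 0 Y] assms by simp
    then have "((\<lambda>r. det (mat_exp Y (r - t))) has_real_derivative 0 * 1) (at t)"
      by (rule DERIV_chain2) (auto intro!: derivative_eq_intros)
    then have "((\<lambda>r. det (mat_exp Y (r - t)) * det (mat_exp Y t)) has_real_derivative 0) (at t)"
      using DERIV_cmult_right by fastforce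
    moreover have "det (mat_exp Y (r - t)) * det (mat_exp Y t) = det (mat_exp Y r)" for r
      by (metis det_mul diff_add_cancel mat_exp_add)
    ultimately show ?thesis
      by simp
  qed
  then have "det (mat_exp Y t) = det (mat_exp Y 0)"
    by (intro DERIV_isconst_all) blast
  then show ?thesis
    by simp
qed

lemma det_flow_semigroup_trace_0:
  assumes "\<And>Y. Y \<in> F \<Longrightarrow> trace Y = 0" "g \<in> flow_semigroup F"
  shows "det g = 1"
  using assms(2,1) by (induction rule: flow_semigroup.induct) (simp_all add: det_mul det_mat_exp_trace_0)

text \<open>An interior point can be moved a little in any prescribed direction; this refutes that a set on which
  some entry vanishes, or the determinant is constant, has interior points.\<close>

lemma interior_direction:
  fixes g v :: "'a::real_normed_vector"
  assumes "g \<in> interior R"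
  obtains e :: real where "0 < e" "g + e *\<^sub>R v \<in> R"
proof -
  obtain r where r: "0 < r" "ball g r \<subseteq> R"
    using assms by (auto simp: mem_interior)
  define e where "e = r / (2 * (norm v + 1))"
  have "norm v * r < r * (2 * (norm v + 1))"
    using r by (simp add: algebra_simps add_strict_increasing)
  then have "e * norm v < r"
    using r by (simp add: e_def field_simps add_pos_nonneg)
  moreover have "0 < e"
    using r unfolding e_def by (intro divide_pos_pos mult_pos_pos add_nonneg_pos) auto
  ultimately have "g + e *\<^sub>R v \<in> R"
    using r by (intro subsetD[OF r(2)]) (simp add: dist_norm)
  then show ?thesis
    using that \<open>0 < e\<close> by blast
qed

text \<open>Since \<open>GL_plus\<close> is open, its relative topology gives the same interior.\<close>

lemma accessible_iff_interior:
  "accessible A m i j \<longleftrightarrow> interior (reachable_set A m i j) \<noteq> {}"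
proof -
  have sub: "reachable_set A m i j \<subseteq> GL_plus"
    unfolding reachable_set_def reachable_at_def trajectory_def by force
  have "(top_of_set GL_plus) interior_of reachable_set A m i j = interior (reachable_set A m i j)"
    unfolding interior_of_def interior_def openin_open_eq[OF open_GL_plus] using sub by blast
  then show ?thesis
    by (simp add: accessible_def)
qed

lemma not_accessible_if_block_zero:
  assumes A: "\<And>a b. a \<in> V \<Longrightarrow> b \<notin> V \<Longrightarrow> A $ a $ b = 0"
    and E: "\<And>k. k \<in> {1..m} \<Longrightarrow> i k \<in> V \<Longrightarrow> j k \<in> V"
    and vw: "v \<in> V" "w \<notin> V"
  shows "\<not> accessible A m i j"
proof
  assume "accessible A m i j"
  then obtain g where "g \<in> interior (flow_semigroup (control_family A m i j))"
    by (auto simp: accessible_iff_interior reachable_set_eq_flow_semigroup)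
  then obtain e where e: "0 < e" "g \<in> flow_semigroup (control_family A m i j)"
    "g + e *\<^sub>R E_mat v w \<in> flow_semigroup (control_family A m i j)"
    using interior_direction[of g _ "E_mat v w"] interior_subset by blast
  have zero: "Y $ a $ b = 0" if "Y \<in> control_family A m i j" "a \<in> V" "b \<notin> V" for Y a b
  proof -
    have "E_mat (i k) (j k) $ a $ b = 0" if "k \<in> {1..m}" for k
      using E[OF that] \<open>a \<in> V\<close> \<open>b \<notin> V\<close> by (auto simp: E_mat_entry)
    then show ?thesis
      using that A by (auto simp: control_family_def)
  qed
  have "g $ v $ w = 0" "(g + e *\<^sub>R E_mat v w) $ v $ w = 0"
    by (rule flow_semigroup_block_zero[OF zero _ vw]; use e in blast)+
  then show False
    using e by (simp add: E_mat_entry)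
qed

lemma not_accessible_if_trace_0:
  fixes A :: "real^'n^'n"
  assumes A: "trace A = 0" and E: "\<And>k. k \<in> {1..m} \<Longrightarrow> i k \<noteq> j k"
  shows "\<not> accessible A m i j"
proof
  assume "accessible A m i j"
  then obtain g where "g \<in> interior (flow_semigroup (control_family A m i j))"
    by (auto simp: accessible_iff_interior reachable_set_eq_flow_semigroup)
  then obtain e where e: "0 < e" "g \<in> flow_semigroup (control_family A m i j)"
    "g + e *\<^sub>R g \<in> flow_semigroup (control_family A m i j)"
    using interior_direction[of g _ g] interior_subset by blast
  have tr: "trace Y = 0" if Y: "Y \<in> control_family A m i j" for Y
  proof -
    obtain c where c: "Y = A + (\<Sum>k = 1..m. c k *\<^sub>R E_mat (i k) (j k))"
      using Y by (auto simp: control_family_def)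
    have "E_mat (i k) (j k) $ a $ a = 0" if "k \<in> {1..m}" for k a
      using E[OF that] by (auto simp: E_mat_entry)
    then have "Y $ a $ a = A $ a $ a" for a
      by (simp add: c)
    then show ?thesis
      using A by (simp add: trace_def)
  qed
  have "g + e *\<^sub>R g = ((1 + e) *\<^sub>R mat 1) ** g"
    by (simp add: mat_mult.add_left mat_mult.scaleR_left scaleR_left_distrib)
  moreover have "det ((1 + e) *\<^sub>R mat 1 :: real^'n^'n) = (1 + e) ^ CARD('n)"
    by (subst det_diagonal) (auto simp: mat_def)
  moreover have "det g = 1" "det (g + e *\<^sub>R g) = 1"
    using det_flow_semigroup_trace_0[OF tr] e by auto
  ultimately have "(1 + e) ^ CARD('n) = 1"
    by (simp add: det_mul)
  then show False
    using e one_less_power[of "1 + e" "CARD('n)"] by simp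
qed

section \<open>Interior points from a generating family\<close>

text \<open>The adjoint action of \<open>exp (s Y)\<close>.\<close>

definition exp_conj :: "real^'n^'n \<Rightarrow> real \<Rightarrow> real^'n^'n \<Rightarrow> real^'n^'n" where
  "exp_conj Y s Z = mat_exp Y s ** Z ** mat_exp Y (- s)"

lemma linear_exp_conj: "linear (exp_conj Y s)"
  by (rule linearI) (simp_all add: exp_conj_def mat_mult.add_left mat_mult.add_right
      mat_mult.scaleR_left mat_mult.scaleR_right)

lemma exp_conj_self: "exp_conj Y s Y = Y"
  by (metis exp_conj_def mat_exp_commute mat_exp_minus' matrix_mul_assoc matrix_mul_rid)

lemma exp_conj_minus: "exp_conj Y (- s) (exp_conj Y s Z) = Z"
proof -
  have "exp_conj Y (- s) (exp_conj Y s Z)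
      = (mat_exp Y (- s) ** mat_exp Y s) ** Z ** (mat_exp Y (- s) ** mat_exp Y s)"
    by (simp add: exp_conj_def matrix_mul_assoc)
  then show ?thesis
    by (simp add: mat_exp_minus)
qed

lemma inj_exp_conj: "inj (exp_conj Y s)"
  by (metis injI exp_conj_minus)

lemma exp_conj_derivative_0:
  "((\<lambda>s. exp_conj Y (- s) Z) has_vector_derivative - commutator Y Z) (at 0 within S)"
proof -
  have "((\<lambda>s. mat_exp Y (0 - s) ** Z ** mat_exp Y s) has_vector_derivative
      (mat_exp Y (0 - 0) ** Z) ** (Y ** mat_exp Y 0)
        + (mat_exp Y (0 - 0) ** 0 + - (mat_exp Y (0 - 0) ** Y) ** Z) ** mat_exp Y 0) (at 0 within S)"
    by (intro mat_mult.has_vector_derivative has_vector_derivative_const mat_exp_backward_derivative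
        has_vector_derivative_at_within[OF has_vector_derivative_mat_exp(1)])
  then show ?thesis
    by (simp add: exp_conj_def commutator_def mat_mult.minus_left)
qed

text \<open>The bracket is, up to sign, the derivative of the conjugation at \<open>s = 0\<close>, and a
  finite-dimensional subspace is closed. Only positive \<open>s\<close> are available because the semigroup
  allows no motion backwards in time; the one-sided limit suffices.\<close>

lemma subspace_commutator_mem:
  assumes W: "subspace W" and mem: "\<And>s. 0 < s \<Longrightarrow> exp_conj Y (- s) Z \<in> W" and Z: "Z \<in> W"
  shows "commutator Y Z \<in> W"
proof -
  let ?f = "\<lambda>s. exp_conj Y (- s) Z"
  have f0: "exp_conj Y 0 Z = Z"
    by (simp add: exp_conj_def)
  have "((\<lambda>s. (1 / norm (s - 0)) *\<^sub>R (?f s - (?f 0 + (s - 0) *\<^sub>R - commutator Y Z))) \<longlongrightarrow> 0) (at_right 0)"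
    using exp_conj_derivative_0[of Y Z "{0<..}"]
    unfolding has_vector_derivative_def has_derivative_within by blast
  then have "((\<lambda>s. (1 / s) *\<^sub>R (?f s - Z) + commutator Y Z) \<longlongrightarrow> 0) (at_right 0)"
    by (rule Lim_transform_eventually)
      (auto simp: eventually_at_filter f0 algebra_simps)
  then have lim: "((\<lambda>s. (1 / s) *\<^sub>R (?f s - Z)) \<longlongrightarrow> - commutator Y Z) (at_right 0)"
    using tendsto_diff[OF _ tendsto_const[of "commutator Y Z"]] by fastforce
  have ev: "\<forall>\<^sub>F s in at_right 0. (1 / s) *\<^sub>R (?f s - Z) \<in> W"
    using mem Z by (intro eventually_mono[OF eventually_at_right_less[of 0]])
      (auto intro!: subspace_scale[OF W] subspace_diff[OF W])
  have "- commutator Y Z \<in> W"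
    by (rule Lim_in_closed_set[OF closed_subspace[OF W] ev _ lim]) simp
  then show ?thesis
    using subspace_neg[OF W] by fastforce
qed

text \<open>\<open>L\<close> is the derivative at \<open>g\<close>, translated on the right to the identity, of a local map into the
  semigroup. The matrix space itself serves as parameter space: its dimension is the largest rank
  that can occur, and a map of full rank then has an invertible derivative.\<close>

definition tangent_map ::
  "(real^'n^'n) set \<Rightarrow> real^'n^'n \<Rightarrow> (real^'n^'n \<Rightarrow> real^'n^'n) \<Rightarrow> bool" where
  "tangent_map F g L \<longleftrightarrow> linear L \<and> (\<exists>H S. open S \<and> 0 \<in> S \<and> continuous_on S H \<and>
     H ` S \<subseteq> flow_semigroup F \<and> H 0 = g \<and> (H has_derivative (\<lambda>x. L x ** g)) (at 0))"

lemma tangent_map_mat_1: "tangent_map F (mat 1) (\<lambda>_. 0)"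
proof -
  have "((\<lambda>_. mat 1) has_derivative (\<lambda>x. 0 ** mat 1)) (at 0)"
    by simp
  then show ?thesis
    unfolding tangent_map_def
    by (intro conjI exI[of _ "\<lambda>_. mat 1"] exI[of _ UNIV])
      (auto intro: flow_semigroup.one linearI)
qed

text \<open>Let the duration of one more exponential factor depend on the parameter as \<open>s + \<phi> x\<close>. Near the base
  point it stays positive because \<open>s\<close> is, which keeps the values in the semigroup.\<close>

lemma tangent_map_step:
  assumes g: "tangent_map F g L" and Y: "Y \<in> F" and s: "0 < s"
    and \<phi>: "linear (\<phi> :: real^'n^'n \<Rightarrow> real)"
  shows "tangent_map F (mat_exp Y s ** g) (\<lambda>x. \<phi> x *\<^sub>R Y + exp_conj Y s (L x))"
proof -
  obtain H S where L: "linear L" and S: "open S" "0 \<in> S" and H: "continuous_on S H"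
    "H ` S \<subseteq> flow_semigroup F" "H 0 = g" "(H has_derivative (\<lambda>x. L x ** g)) (at 0)"
    using g unfolding tangent_map_def by blast
  define S' where "S' = S \<inter> {x. 0 < s + \<phi> x}"
  define H' where "H' x = mat_exp Y (s + \<phi> x) ** H x" for x
  have bl: "bounded_linear \<phi>"
    using \<phi> by (simp add: linear_conv_bounded_linear)
  have cont\<phi>: "continuous_on U (\<lambda>x. s + \<phi> x)" for U
    by (intro continuous_intros bounded_linear.continuous_on[OF bl])
  have \<phi>0: "\<phi> 0 = 0"
    using linear_0[OF \<phi>] .
  have "open S'"
    unfolding S'_def by (intro open_Int S open_Collect_less continuous_on_const cont\<phi>)
  moreover have "0 \<in> S'"
    using S s \<phi>0 by (simp add: S'_def)
  moreover have "continuous_on S' H'"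
    unfolding H'_def S'_def
    by (intro mat_mult.continuous_on continuous_on_mat_exp cont\<phi> continuous_on_subset[OF H(1)]) auto
  moreover have "H' ` S' \<subseteq> flow_semigroup F"
    using H(2) Y by (auto simp: H'_def S'_def intro!: flow_semigroup.step)
  moreover have "H' 0 = mat_exp Y s ** g"
    by (simp add: H'_def \<phi>0 H)
  moreover have "(H' has_derivative (\<lambda>x. (\<phi> x *\<^sub>R Y + exp_conj Y s (L x)) ** (mat_exp Y s ** g))) (at 0)"
  proof -
    have "((\<lambda>x. s + \<phi> x) has_derivative \<phi>) (at 0)"
      using has_derivative_add[OF has_derivative_const[of s] bounded_linear_imp_has_derivative[OF bl]]
      by simp
    moreover have "(mat_exp Y has_derivative (\<lambda>h. h *\<^sub>R (Y ** mat_exp Y s))) (at (s + \<phi> 0))"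
      using has_vector_derivative_mat_exp(1)[of Y s] by (simp add: has_vector_derivative_def \<phi>0)
    ultimately have "((\<lambda>x. mat_exp Y (s + \<phi> x)) has_derivative (\<lambda>x. \<phi> x *\<^sub>R (Y ** mat_exp Y s))) (at 0)"
      by (rule has_derivative_compose)
    from mat_mult.FDERIV[OF this H(4)]
    have "(H' has_derivative (\<lambda>x. mat_exp Y s ** (L x ** g) + \<phi> x *\<^sub>R (Y ** mat_exp Y s) ** g)) (at 0)"
      by (simp add: H'_def[abs_def] \<phi>0 H)
    moreover have "mat_exp Y s ** (L x ** g) + \<phi> x *\<^sub>R (Y ** mat_exp Y s) ** g
        = (\<phi> x *\<^sub>R Y + exp_conj Y s (L x)) ** (mat_exp Y s ** g)" for x
    proof -
      have "exp_conj Y s (L x) ** (mat_exp Y s ** g)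
          = mat_exp Y s ** L x ** (mat_exp Y (- s) ** mat_exp Y s) ** g"
        by (simp add: exp_conj_def matrix_mul_assoc)
      also have "\<dots> = mat_exp Y s ** (L x ** g)"
        by (simp add: mat_exp_minus matrix_mul_assoc)
      finally show ?thesis
        by (simp add: mat_mult.add_left mat_mult.scaleR_left matrix_mul_assoc)
    qed
    ultimately show ?thesis
      by simp
  qed
  moreover have "linear (\<lambda>x. \<phi> x *\<^sub>R Y + exp_conj Y s (L x))"
    using linear_compose[OF L linear_exp_conj] \<phi>
    by (intro linear_compose_add) (auto simp: o_def linear_iff scaleR_left_distrib)
  ultimately show ?thesis
    unfolding tangent_map_def by blast
qed

text \<open>Choose \<open>\<phi>\<close> with \<open>\<phi> x0 = 1\<close> at a kernel vector \<open>x0\<close> of \<open>L\<close>. The new range contains \<open>Y\<close> and the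
  conjugate of the old range; maximality makes it equal to that conjugate. So \<open>Y\<close>, which
  conjugation by its own exponential fixes, was already in the old range.\<close>

lemma tangent_map_maximal_rank_step:
  assumes g: "tangent_map F g L"
    and max: "\<And>g' L'. tangent_map F g' L' \<Longrightarrow> dim (range L') \<le> dim (range L)"
    and not_onto: "range L \<noteq> UNIV" and Y: "Y \<in> F" and s: "0 < s"
  shows "Y \<in> range L"
    and "\<exists>g' L'. tangent_map F g' L' \<and> range L' = exp_conj Y s ` range L \<and> dim (range L') = dim (range L)"
proof -
  have L: "linear L"
    using g by (simp add: tangent_map_def)
  have "\<not> inj L"
    using linear_injective_imp_surjective[OF L] not_onto by blast
  then obtain x0 where x0: "L x0 = 0" "x0 \<noteq> 0"
    using linear_injective_0[OF L] by blast
  define \<phi> where "\<phi> x = (x \<bullet> x0) / (x0 \<bullet> x0)" for x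
  have \<phi>: "linear \<phi>" "\<phi> x0 = 1"
    using x0 by (auto simp: \<phi>_def inner_add_left add_divide_distrib intro!: linearI)
  define L' where "L' x = \<phi> x *\<^sub>R Y + exp_conj Y s (L x)" for x
  have t: "tangent_map F (mat_exp Y s ** g) L'"
    unfolding L'_def by (rule tangent_map_step[OF g Y s \<phi>(1)])
  then have L': "linear L'"
    by (simp add: tangent_map_def)
  have "L' x0 = Y"
    using x0 \<phi>(2) linear_0[OF linear_exp_conj] by (simp add: L'_def)
  then have YL': "Y \<in> range L'"
    by (metis rangeI)
  have "exp_conj Y s (L x) = L' (x - \<phi> x *\<^sub>R x0)" for x
    using x0 \<phi> by (simp add: L'_def linear_diff[OF L] linear_scale[OF L] linear_diff[OF \<phi>(1)] linear_scale[OF \<phi>(1)])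
  then have sub: "exp_conj Y s ` range L \<subseteq> range L'"
    by auto
  have dim: "dim (exp_conj Y s ` range L) = dim (range L)"
    by (rule dim_image_eq[OF linear_exp_conj]) (rule inj_on_subset[OF inj_exp_conj subset_UNIV])
  have eq: "exp_conj Y s ` range L = range L'"
  proof (rule subspace_dim_equal[OF _ _ sub])
    show "subspace (exp_conj Y s ` range L)"
      by (intro linear_subspace_image linear_exp_conj L subspace_UNIV)
    show "subspace (range L')"
      by (intro linear_subspace_image L' subspace_UNIV)
    show "dim (range L') \<le> dim (exp_conj Y s ` range L)"
      using max[OF t] dim by simp
  qed
  show "\<exists>g' L'. tangent_map F g' L' \<and> range L' = exp_conj Y s ` range L \<and> dim (range L') = dim (range L)"
    using t eq dim by metis
  from YL' eq obtain x where "exp_conj Y s (L x) = exp_conj Y s Y"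
    by (metis (no_types, lifting) exp_conj_self imageE)
  then have "Y = L x"
    using inj_exp_conj by (metis injD)
  then show "Y \<in> range L"
    by blast
qed

text \<open>A continuous map whose derivative at a point has a right inverse sends a neighbourhood of the point
  onto a neighbourhood of its value.\<close>

lemma interior_flow_semigroup_nonempty_if_onto:
  assumes g: "tangent_map F g L" and onto: "range L = UNIV"
  shows "interior (flow_semigroup F) \<noteq> {}"
proof -
  obtain H S where L: "linear L" and S: "open S" "0 \<in> S" and H: "continuous_on S H"
    "H ` S \<subseteq> flow_semigroup F" "H 0 = g" "(H has_derivative (\<lambda>x. L x ** g)) (at 0)"
    using g unfolding tangent_map_def by blast
  have "g \<in> flow_semigroup F"
    using H(2,3) S(2) by blast
  then obtain h where h: "h ** g = mat 1"
    using invertible_flow_semigroup unfolding invertible_def by blast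
  obtain M where M: "linear M" "L \<circ> M = id"
    using linear_surjective_right_inverse[OF L onto] by blast
  have "H 0 \<in> interior (H ` S)"
  proof (rule sussmann_open_mapping[OF S(1) H(1) S(2) H(4)])
    show "bounded_linear (\<lambda>y. M (y ** h))"
      using M(1) mat_mult.bounded_linear_left[of h] bounded_linear_compose linear_conv_bounded_linear
      by blast
    show "(\<lambda>x. L x ** g) \<circ> (\<lambda>y. M (y ** h)) = id"
      using M(2) h by (auto simp: fun_eq_iff matrix_mul_assoc[symmetric])
    show "0 \<in> interior S"
      using S by (simp add: interior_open)
  qed simp
  then show ?thesis
    using interior_mono[OF H(2)] by blast
qed

text \<open>The hypothesis says that iterated brackets of members of \<open>F\<close> span all matrices. It is applied
  to the intersection of all ranges of maximal rank.\<close>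

theorem interior_flow_semigroup_nonempty:
  assumes gen: "\<And>U. subspace U \<Longrightarrow> F \<subseteq> U \<Longrightarrow> (\<And>Y Z. Y \<in> F \<Longrightarrow> Z \<in> U \<Longrightarrow> commutator Y Z \<in> U) \<Longrightarrow> U = UNIV"
  shows "interior (flow_semigroup F :: (real^'n^'n) set) \<noteq> {}"
proof -
  define P where "P p = tangent_map F (fst p) (snd p)"
    for p :: "(real^'n^'n) \<times> (real^'n^'n \<Rightarrow> real^'n^'n)"
  have "P (mat 1, \<lambda>_. 0)"
    by (simp add: P_def tangent_map_mat_1)
  moreover have "\<forall>p. P p \<longrightarrow> dim (range (snd p)) < DIM(real^'n^'n) + 1"
    using dim_subset_UNIV[where 'a = "real^'n^'n"] by (metis add.commute less_Suc_eq_le plus_1_eq_Suc)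
  ultimately obtain p where p: "P p" "\<forall>q. P q \<longrightarrow> dim (range (snd q)) \<le> dim (range (snd p))"
    using ex_has_greatest_nat[of P _ "\<lambda>p. dim (range (snd p))"] by blast
  define r where "r = dim (range (snd p))"
  have max: "dim (range L) \<le> r" if "tangent_map F g L" for g L
    using p(2) that unfolding P_def r_def by fastforce
  \<comment> \<open>The ranges of maximal rank; if the rank is full, the only one is the whole space.\<close>
  define \<W> where "\<W> = {range L | g L. tangent_map F g L \<and> dim (range L) = r}"
  have ne: "\<W> \<noteq> {}"
    using p(1) unfolding \<W>_def P_def r_def by blast
  show ?thesis
  proof (cases "UNIV \<in> \<W>")
    case True
    then show ?thesis
      using interior_flow_semigroup_nonempty_if_onto unfolding \<W>_def
      by (smt (verit, best) mem_Collect_eq)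
  next
    case False
    have step: "Y \<in> W" "exp_conj Y s ` W \<in> \<W>" if W: "W \<in> \<W>" and Y: "Y \<in> F" and s: "0 < s" for W Y s
    proof -
      obtain g L where L: "W = range L" "tangent_map F g L" "dim (range L) = r"
        using W unfolding \<W>_def by blast
      have "range L \<noteq> UNIV"
        using False L W by auto
      from tangent_map_maximal_rank_step[OF L(2) _ this Y s] max L
      show "Y \<in> W" "exp_conj Y s ` W \<in> \<W>"
        unfolding \<W>_def by (metis, smt (verit, best) mem_Collect_eq)
    qed
    have sub: "subspace W" if "W \<in> \<W>" for W
      using that unfolding \<W>_def tangent_map_def by (auto intro: linear_subspace_image subspace_UNIV)
    have "\<Inter>\<W> = UNIV"
    proof (rule gen)
      show "subspace (\<Inter>\<W>)"
        using sub by (auto intro: subspace_Inter)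
      show "F \<subseteq> \<Inter>\<W>"
        using step(1)[OF _ _ zero_less_one] by blast
      fix Y Z assume Y: "Y \<in> F" and Z: "Z \<in> \<Inter>\<W>"
      show "commutator Y Z \<in> \<Inter>\<W>"
      proof
        fix W assume W: "W \<in> \<W>"
        show "commutator Y Z \<in> W"
        proof (rule subspace_commutator_mem[OF sub[OF W]])
          show "Z \<in> W"
            using Z W by blast
          fix s :: real assume "0 < s"
          then have "Z \<in> exp_conj Y s ` W"
            using step(2)[OF W Y] Z by blast
          then show "exp_conj Y (- s) Z \<in> W"
            by (auto simp: exp_conj_minus)
        qed
      qed
    qed
    then show ?thesis
      using False ne by (metis Inter_lower subset_UNIV ex_in_conv subset_antisym)
  qed
qed

section \<open>Accessibility and the interaction graphs\<close>

text \<open>The family contains \<open>A\<close> (all controls zero) and \<open>A + E_mat (i k) (j k)\<close>, and brackets are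
  linear, so stability under the family amounts to stability under \<open>A\<close> and the
  \<open>E_mat (i k) (j k)\<close>.\<close>

lemma accessible_if_lie_algebra_full:
  assumes full: "\<And>N. lie_subalgebra N \<Longrightarrow> A \<in> N \<Longrightarrow> (\<And>k. k \<in> {1..m} \<Longrightarrow> E_mat (i k) (j k) \<in> N) \<Longrightarrow> N = UNIV"
  shows "accessible A m i j"
proof -
  have "interior (flow_semigroup (control_family A m i j)) \<noteq> {}"
  proof (rule interior_flow_semigroup_nonempty)
    fix U assume U: "subspace U" and sub: "control_family A m i j \<subseteq> U"
      and comm: "\<And>Y Z. Y \<in> control_family A m i j \<Longrightarrow> Z \<in> U \<Longrightarrow> commutator Y Z \<in> U"
    \<comment> \<open>\<open>U\<close> is not known to be a Lie algebra, so the hypothesis is applied to a subset of it that is one.\<close>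
    let ?N = "{Z \<in> U. \<forall>X\<in>U. commutator Z X \<in> U}"
    have fam: "A + (\<Sum>k = 1..m. c k *\<^sub>R E_mat (i k) (j k)) \<in> control_family A m i j" for c
      by (auto simp: control_family_def)
    have A: "A \<in> control_family A m i j"
      using fam[of "\<lambda>_. 0"] by simp
    have AE: "A + E_mat (i k) (j k) \<in> control_family A m i j" if "k \<in> {1..m}" for k
    proof -
      have "(\<Sum>l = 1..m. (if l = k then 1 else 0) *\<^sub>R E_mat (i l) (j l)) = E_mat (i k) (j k)"
        using that by (simp add: if_distrib[of "\<lambda>r. r *\<^sub>R _"] cong: if_cong)
      then show ?thesis
        using fam[of "\<lambda>l. if l = k then 1 else 0"] by simp
    qed
    have "?N = UNIV"
    proof (rule full[OF lie_subalgebra_normalizer[OF U]])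
      show "A \<in> ?N"
        using A sub comm by blast
      fix k assume k: "k \<in> {1..m}"
      have "(A + E_mat (i k) (j k)) - A \<in> U"
        using AE[OF k] A sub by (intro subspace_diff[OF U]) blast+
      moreover have "commutator (E_mat (i k) (j k)) Z \<in> U" if "Z \<in> U" for Z
      proof -
        have "commutator (E_mat (i k) (j k)) Z = commutator (A + E_mat (i k) (j k)) Z - commutator A Z"
          by (simp add: commutator_def mat_mult.add_left mat_mult.add_right)
        then show ?thesis
          using subspace_diff[OF U comm[OF AE[OF k] that] comm[OF A that]] by simp
      qed
      ultimately show "E_mat (i k) (j k) \<in> ?N"
        by simp
    qed
    then show "U = UNIV"
      by blast
  qed
  then show ?thesis
    by (simp add: accessible_iff_interior reachable_set_eq_flow_semigroup)
qed

lemma strongly_connected_union_iff: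
  "strongly_connected (Digraph_Component.union (drift_graph A) (contr_graph m i j)) \<longleftrightarrow>
   (\<forall>v w. (v, w) \<in> ((\<lambda>k. (i k, j k)) ` {1..m} \<union> {(v, w). A $ v $ w \<noteq> 0})\<^sup>*)"
proof -
  have "Digraph_Component.union (drift_graph A) (contr_graph m i j)
      = with_proj \<lparr>pverts = UNIV, parcs = (\<lambda>k. (i k, j k)) ` {1..m} \<union> {(v, w). A $ v $ w \<noteq> 0}\<rparr>"
    by (auto simp: Digraph_Component.union_def drift_graph_def contr_graph_def with_proj_def)
  then show ?thesis
    by (simp add: strongly_connected_def reachable_with_proj_iff)
qed

theorem theorem4:
  fixes A :: "real^'n^'n" and m :: nat and i j :: "nat \<Rightarrow> 'n"
  assumes "\<forall>H \<in> weak_components (contr_graph m i j).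
             strongly_connected H \<and> card (verts H) \<ge> 2"
    and "\<exists>H \<in> weak_components (contr_graph m i j). card (verts H) \<ge> 3"
  shows "accessible A m i j \<longleftrightarrow>
           strongly_connected (Digraph_Component.union (drift_graph A) (contr_graph m i j)) \<and>
           ((\<exists>v. (v, v) \<in> arcs (contr_graph m i j)) \<or> trace A \<noteq> 0)"
proof -
  define R where "R = (\<lambda>k. (i k, j k)) ` {1..m}"
  note sc = strongly_connected_union_iff[of A m i j, folded R_def]
  have loop: "(v, v) \<in> arcs (contr_graph m i j) \<longleftrightarrow> (v, v) \<in> R" for v
    by (simp add: contr_graph_def R_def)
  have contr: "contr_graph m i j = with_proj \<lparr>pverts = UNIV, parcs = R\<rparr>"
    by (simp add: contr_graph_def R_def)
  note comps = weak_components_strongly_connected[OF assms[unfolded contr]]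
  show ?thesis
  proof (intro iffI conjI)
    assume acc: "accessible A m i j"
    show "strongly_connected (Digraph_Component.union (drift_graph A) (contr_graph m i j))"
      unfolding sc
    proof (intro allI)
      fix v w
      let ?R = "R \<union> {(v, w). A $ v $ w \<noteq> 0}"
      show "(v, w) \<in> ?R\<^sup>*"
      proof (rule ccontr)
        assume nreach: "(v, w) \<notin> ?R\<^sup>*"
        have closed: "b \<in> {b. (v, b) \<in> ?R\<^sup>*}" if "a \<in> {b. (v, b) \<in> ?R\<^sup>*}" "(a, b) \<in> ?R" for a b
          using that by (auto intro: rtrancl_into_rtrancl)
        have "\<not> accessible A m i j"
        proof (rule not_accessible_if_block_zero)
          show "v \<in> {b. (v, b) \<in> ?R\<^sup>*}" "w \<notin> {b. (v, b) \<in> ?R\<^sup>*}"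
            using nreach by auto
          show "A $ a $ b = 0" if "a \<in> {b. (v, b) \<in> ?R\<^sup>*}" "b \<notin> {b. (v, b) \<in> ?R\<^sup>*}" for a b
            using closed[OF that(1), of b] that(2) by blast
          show "j k \<in> {b. (v, b) \<in> ?R\<^sup>*}" if "k \<in> {1..m}" "i k \<in> {b. (v, b) \<in> ?R\<^sup>*}" for k
            using closed[OF that(2), of "j k"] that(1) by (auto simp: R_def)
        qed
        then show False
          using acc by blast
      qed
    qed
    show "(\<exists>v. (v, v) \<in> arcs (contr_graph m i j)) \<or> trace A \<noteq> 0"
      using not_accessible_if_trace_0[of A m i j] acc unfolding loop R_def by force
  next
    assume conn: "strongly_connected (Digraph_Component.union (drift_graph A) (contr_graph m i j)) \<and>
           ((\<exists>v. (v, v) \<in> arcs (contr_graph m i j)) \<or> trace A \<noteq> 0)"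
    obtain x y z where xyz: "x \<noteq> y" "y \<noteq> z" "x \<noteq> z" "(x, y) \<in> R\<^sup>*" "(x, z) \<in> R\<^sup>*"
      using comps(3) by blast
    show "accessible A m i j"
    proof (rule accessible_if_lie_algebra_full)
      fix N :: "(real^'n^'n) set"
      assume N: "lie_subalgebra N" "A \<in> N" and E: "\<And>k. k \<in> {1..m} \<Longrightarrow> E_mat (i k) (j k) \<in> N"
      show "N = UNIV"
      proof (rule lie_subalgebra_eq_UNIV[OF N _ comps(1) comps(2) xyz])
        show "E_mat a b \<in> N" if "(a, b) \<in> R" for a b
          using that E by (auto simp: R_def)
        show "(v, w) \<in> (R \<union> {(v, w). A $ v $ w \<noteq> 0})\<^sup>*" for v w
          using conn unfolding sc by blast
        show "(\<exists>v. (v, v) \<in> R) \<or> trace A \<noteq> 0"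
          using conn unfolding loop by blast
      qed
    qed
  qed
qed

end
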